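(* Let $k\in\{3,4\}$ and let $n\geq 2k+1$ be an integer. Then the toughness of the Kneser graph $K(n,k)$ equals $$t(K(n,k))=\frac{n}{k}-1.$$ Moreover, any subset of vertices $S$ satisfying $t(K(n,k))=\frac{|S|}{c(K(n,k)\setminus S)}$ must be the complement of a maximum independent set in $K(n,k)$.
   Context: For integers $n\geq 2k+1$, $k\ge 1$, the Kneser graph $K(n,k)$ has as vertices the $k$-element subsets of $[n]=\{1,\dots,n\}$, two vertices $A,B$ being adjacent iff $A\cap B=\emptyset$. For a connected graph $G$, a vertex cut is a set $S$ of vertices whose removal disconnects $G$; $c(G\setminus S)$ denotes the number of connected components of the graph obtained by deleting $S$. The toughness of $G$ is $t(G)=\min_S \frac{|S|}{c(G\setminus S)}$, the minimum over all vertex cuts $S$ of $G$.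
   Formalization: In the second claim S is required to be a vertex cut; for arbitrary subsets it fails, e.g. k=3, n=9 and S any two vertices, where c(K(9,3)\S)=1 and |S|/c=2=n/k-1. *)

theory Defs
  imports Complex_Main
begin

text \<open>Simple graphs given by a vertex set V and a symmetric adjacency predicate E.\<close>

definition conn_rel :: "'a set \<Rightarrow> ('a \<Rightarrow> 'a \<Rightarrow> bool) \<Rightarrow> ('a \<times> 'a) set" where
  "conn_rel V E = {(x, y). x \<in> V \<and> y \<in> V \<and> (\<lambda>a b. a \<in> V \<and> b \<in> V \<and> E a b)\<^sup>*\<^sup>* x y}"

definition num_components :: "'a set \<Rightarrow> ('a \<Rightarrow> 'a \<Rightarrow> bool) \<Rightarrow> nat" where
  "num_components V E = card (V // conn_rel V E)"

definition is_vertex_cut :: "'a set \<Rightarrow> ('a \<Rightarrow> 'a \<Rightarrow> bool) \<Rightarrow> 'a set \<Rightarrow> bool" where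
  "is_vertex_cut V E S \<longleftrightarrow> S \<subseteq> V \<and> num_components (V - S) E \<ge> 2"

definition toughness :: "'a set \<Rightarrow> ('a \<Rightarrow> 'a \<Rightarrow> bool) \<Rightarrow> real" where
  "toughness V E = Min {real (card S) / real (num_components (V - S) E) | S. is_vertex_cut V E S}"

definition independent_set :: "'a set \<Rightarrow> ('a \<Rightarrow> 'a \<Rightarrow> bool) \<Rightarrow> 'a set \<Rightarrow> bool" where
  "independent_set V E I \<longleftrightarrow> I \<subseteq> V \<and> (\<forall>x\<in>I. \<forall>y\<in>I. \<not> E x y)"

definition maximum_independent_set :: "'a set \<Rightarrow> ('a \<Rightarrow> 'a \<Rightarrow> bool) \<Rightarrow> 'a set \<Rightarrow> bool" where
  "maximum_independent_set V E I \<longleftrightarrow> independent_set V E I \<and>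
     (\<forall>J. independent_set V E J \<longrightarrow> card J \<le> card I)"

definition kneser_verts :: "nat \<Rightarrow> nat \<Rightarrow> nat set set" where
  "kneser_verts n k = {A. A \<subseteq> {1..n} \<and> card A = k}"

definition kneser_adj :: "nat set \<Rightarrow> nat set \<Rightarrow> bool" where
  "kneser_adj A B \<longleftrightarrow> A \<inter> B = {}"

end

theory Submission
  imports Defs
begin

text \<open>
  Let \<open>N\<close>, \<open>d\<close>, \<open>-\<tau>\<close> be the number of vertices, the degree and the least eigenvalue of the Kneser
  graph, so \<open>d / \<tau> = n / k - 1\<close>. Let the components \<open>C\<^sub>i\<close> left by a cut have \<open>m\<^sub>i\<close> vertices and \<open>e\<^sub>i / 2\<close>
  edges. Applying the inequality behind Hoffman's ratio bound to a function that is constant on each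
  component, with the best constants, gives
  \<open>\<Sum>\<^sub>i m\<^sub>i\<^sup>2 / (e\<^sub>i + \<tau> m\<^sub>i) \<le> N / (d + \<tau>)\<close>. If every component satisfies
  \<open>m\<^sub>i + d / \<tau> \<le> (d + \<tau>) m\<^sub>i\<^sup>2 / (e\<^sub>i + \<tau> m\<^sub>i)\<close>, then summation yields \<open>(d / \<tau>) c \<le> |S|\<close>.
  For a single vertex this is an equality; for \<open>m\<^sub>i \<ge> 2\<close> it is a strict edge-isoperimetric inequality,
  which follows from the second largest eigenvalue and \<open>m\<^sub>i \<le> N - d - 1\<close>. Hence equality forces
  all components to be singletons, that is, an independent set attaining the ratio bound.
\<close>

section \<open>Quadratic forms on the k-subsets of a finite set\<close>

definition layer :: "'a set \<Rightarrow> nat \<Rightarrow> 'a set set" where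
  "layer V i = {R. R \<subseteq> V \<and> card R = i}"

definition upsum :: "'a set \<Rightarrow> nat \<Rightarrow> ('a set \<Rightarrow> real) \<Rightarrow> 'a set \<Rightarrow> real" where
  "upsum V k f R = (\<Sum>A\<in>layer V k. if R \<subseteq> A then f A else 0)"

text \<open>The quadratic form of the Gram matrix of the inclusion matrix between
  \<open>i\<close>-sets and \<open>k\<close>-sets. These forms depend on two \<open>k\<close>-sets
  only through the size of their intersection, so they serve as coordinates for the forms of the
  Johnson scheme.\<close>

definition energy :: "'a set \<Rightarrow> nat \<Rightarrow> ('a set \<Rightarrow> real) \<Rightarrow> nat \<Rightarrow> real" where
  "energy V k f i = (\<Sum>R\<in>layer V i. (upsum V k f R)\<^sup>2)"

definition kneser_form :: "'a set \<Rightarrow> nat \<Rightarrow> ('a set \<Rightarrow> real) \<Rightarrow> real" where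
  "kneser_form V k f = (\<Sum>A\<in>layer V k. \<Sum>B\<in>layer V k. if A \<inter> B = {} then f A * f B else 0)"

lemma finite_layer: "finite V \<Longrightarrow> finite (layer V i)"
  unfolding layer_def by simp

section \<open>Inclusion-exclusion: the Kneser form as an alternating sum of energies\<close>

lemma sum_Pow_layers:
  fixes g :: "'a set \<Rightarrow> real"
  assumes "finite V" and "\<And>R. R \<subseteq> V \<Longrightarrow> card R > m \<Longrightarrow> g R = 0"
  shows "(\<Sum>R\<in>Pow V. g R) = (\<Sum>i\<le>m. \<Sum>R\<in>layer V i. g R)"
proof -
  have "(\<Sum>R\<in>Pow V. g R) = (\<Sum>R\<in>{R\<in>Pow V. card R \<le> m}. g R)"
    using assms by (intro sum.mono_neutral_right) (auto simp: not_le)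
  also have "\<dots> = (\<Sum>i\<le>m. \<Sum>R\<in>{R\<in>{R\<in>Pow V. card R \<le> m}. card R = i}. g R)"
    using assms(1) by (intro sum.group[symmetric]) auto
  also have "\<dots> = (\<Sum>i\<le>m. \<Sum>R\<in>layer V i. g R)"
    by (intro sum.cong) (auto simp: layer_def)
  finally show ?thesis .
qed

lemma sum_Pow_insert:
  fixes g :: "'a set \<Rightarrow> real"
  assumes "finite T" "x \<notin> T"
  shows "(\<Sum>R\<in>Pow (insert x T). g R) = (\<Sum>R\<in>Pow T. g R + g (insert x R))"
proof -
  have "inj_on (insert x) (Pow T)"
    using assms(2) by (auto simp: inj_on_def)
  moreover have "Pow T \<inter> insert x ` Pow T = {}"
    using assms(2) by auto
  ultimately show ?thesis
    using assms(1) by (simp add: Pow_insert sum.union_disjoint sum.reindex sum.distrib)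
qed

lemma sum_Pow_alternating:
  assumes "finite T"
  shows "(\<Sum>R\<in>Pow T. (-1::real) ^ card R) = (if T = {} then 1 else 0)"
proof (cases "T = {}")
  case False
  then obtain x U where T: "T = insert x U" "x \<notin> U"
    by (meson Set.set_insert ex_in_conv)
  have "(-1::real) ^ card R + (-1) ^ card (insert x R) = 0" if "R \<in> Pow U" for R
    using that T assms by (subst card_insert_disjoint) (auto intro: finite_subset)
  then show ?thesis
    using T assms by (simp add: sum_Pow_insert)
qed simp

lemma upsum_eq_0: "finite V \<Longrightarrow> card R > k \<Longrightarrow> upsum V k f R = 0"
  unfolding upsum_def layer_def
  by (intro sum.neutral) (auto dest: card_mono[rotated] finite_subset)

lemma upsum_top:
  assumes "finite V" "R \<in> layer V k"
  shows "upsum V k f R = f R"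
proof -
  have "R \<subseteq> A \<longleftrightarrow> A = R" if "A \<in> layer V k" for A
    using that assms card_subset_eq[of A R] by (auto simp: layer_def dest: finite_subset)
  then have "upsum V k f R = (\<Sum>A\<in>layer V k. if A = R then f R else 0)"
    unfolding upsum_def by (intro sum.cong) auto
  then show ?thesis
    using assms finite_layer[OF assms(1), of k] by simp
qed

text \<open>The sum of \<open>(-1) ^ card R\<close> over all subsets \<open>R\<close> of
  \<open>A \<inter> B\<close> is the indicator of disjointness. Summing it against
  \<open>f A * f B\<close> and exchanging the sums collects, for each \<open>R\<close>, the square
  of \<open>upsum V k f R\<close>.\<close>

lemma kneser_form_energy:
  assumes "finite V"
  shows "kneser_form V k f = (\<Sum>i\<le>k. (-1) ^ i * energy V k f i)"
proof -
  have "(\<Sum>i\<le>k. (-1) ^ i * energy V k f i)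
      = (\<Sum>i\<le>k. \<Sum>R\<in>layer V i. (-1) ^ card R * (upsum V k f R)\<^sup>2)"
    unfolding energy_def sum_distrib_left by (intro sum.cong) (auto simp: layer_def)
  also have "\<dots> = (\<Sum>R\<in>Pow V. (-1) ^ card R * (upsum V k f R)\<^sup>2)"
    using assms by (intro sum_Pow_layers[symmetric]) (auto simp: upsum_eq_0)
  also have "\<dots> = (\<Sum>R\<in>Pow V. \<Sum>A\<in>layer V k. \<Sum>B\<in>layer V k.
      if R \<subseteq> A \<inter> B then (-1) ^ card R * (f A * f B) else 0)"
    unfolding upsum_def power2_eq_square sum_product
    unfolding sum_distrib_left by (intro sum.cong) auto
  also have "\<dots> = (\<Sum>A\<in>layer V k. \<Sum>R\<in>Pow V. \<Sum>B\<in>layer V k.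
      if R \<subseteq> A \<inter> B then (-1) ^ card R * (f A * f B) else 0)"
    by (rule sum.swap)
  also have "\<dots> = (\<Sum>A\<in>layer V k. \<Sum>B\<in>layer V k. \<Sum>R\<in>Pow V.
      if R \<subseteq> A \<inter> B then (-1) ^ card R * (f A * f B) else 0)"
    by (intro sum.cong refl sum.swap)
  also have "\<dots> = kneser_form V k f"
    unfolding kneser_form_def
  proof (intro sum.cong refl)
    fix A B assume AB: "A \<in> layer V k" "B \<in> layer V k"
    have "(\<Sum>R\<in>Pow V. if R \<subseteq> A \<inter> B then (-1) ^ card R * (f A * f B) else 0)
        = (\<Sum>R\<in>Pow (A \<inter> B). (-1) ^ card R * (f A * f B))"
      using AB assms by (intro sum.mono_neutral_cong_right) (auto simp: layer_def)
    also have "\<dots> = (\<Sum>R\<in>Pow (A \<inter> B). (-1) ^ card R) * (f A * f B)"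
      by (simp add: sum_distrib_right)
    also have "\<dots> = (if A \<inter> B = {} then f A * f B else 0)"
      using AB assms by (subst sum_Pow_alternating) (auto simp: layer_def intro: finite_subset)
    finally show "(\<Sum>R\<in>Pow V. if R \<subseteq> A \<inter> B then (-1) ^ card R * (f A * f B) else 0)
        = (if A \<inter> B = {} then f A * f B else 0)" .
  qed
  finally show ?thesis ..
qed

section \<open>Harmonic projections in the Johnson scheme\<close>

lemma sum_upsum_insert:
  assumes "finite V" "R \<subseteq> V"
  shows "(\<Sum>x\<in>V - R. upsum V k f (insert x R)) = (real k - real (card R)) * upsum V k f R"
proof -
  have "(\<Sum>x\<in>V - R. upsum V k f (insert x R))
      = (\<Sum>A\<in>layer V k. \<Sum>x\<in>V - R. if insert x R \<subseteq> A then f A else 0)"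
    unfolding upsum_def by (rule sum.swap)
  \<comment> \<open>A set \<open>A\<close> that contains \<open>R\<close> is counted once for each
    of the \<open>k - card R\<close> elements of \<open>A - R\<close>.\<close>
  also have "\<dots> = (\<Sum>A\<in>layer V k. (real k - real (card R)) * (if R \<subseteq> A then f A else 0))"
  proof (intro sum.cong refl)
    fix A assume A: "A \<in> layer V k"
    show "(\<Sum>x\<in>V - R. if insert x R \<subseteq> A then f A else 0)
        = (real k - real (card R)) * (if R \<subseteq> A then f A else 0)"
    proof (cases "R \<subseteq> A")
      case True
      have "finite A" "A \<subseteq> V" "card A = k"
        using A assms(1) by (auto simp: layer_def intro: finite_subset)
      have "(\<Sum>x\<in>V - R. if insert x R \<subseteq> A then f A else 0) = (\<Sum>x\<in>A - R. f A)"
        using assms(1) True \<open>A \<subseteq> V\<close> by (intro sum.mono_neutral_cong_right) auto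
      also have "\<dots> = (real k - real (card R)) * f A"
        using True \<open>finite A\<close> \<open>card A = k\<close> card_mono[of A R]
        by (simp add: card_Diff_subset finite_subset of_nat_diff)
      finally show ?thesis using True by simp
    qed (auto intro!: sum.neutral)
  qed
  also have "\<dots> = (real k - real (card R)) * upsum V k f R"
    unfolding upsum_def by (simp add: sum_distrib_left)
  finally show ?thesis .
qed

text \<open>
  If \<open>c\<close> satisfies the recursion assumed in \<open>harmonic_lift_sum_insert\<close>, this is, up to scaling, the
  projection of \<open>f\<close> onto the \<open>j\<close>-th eigenspace of the Johnson scheme, seen as a function on \<open>j\<close>-sets;
  nonnegativity of its norm is the only source of spectral information below.
\<close>

definition harmonic_lift :: "'a set \<Rightarrow> nat \<Rightarrow> ('a set \<Rightarrow> real) \<Rightarrow> (nat \<Rightarrow> real) \<Rightarrow> 'a set \<Rightarrow> real" where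
  "harmonic_lift V k f c T = (\<Sum>R\<in>Pow T. c (card R) * upsum V k f R)"

text \<open>Double counting of the pairs of a subset of \<open>T\<close> and an element of it: a set
  \<open>R\<close> arises by insertion from exactly \<open>card R\<close> pairs.\<close>

lemma sum_Pow_insert_inside:
  fixes g :: "'a set \<Rightarrow> real"
  assumes "finite T"
  shows "(\<Sum>R\<in>Pow T. \<Sum>x\<in>T - R. g (insert x R)) = (\<Sum>R\<in>Pow T. real (card R) * g R)"
proof -
  have "(\<Sum>R\<in>Pow T. \<Sum>x\<in>T - R. g (insert x R)) = (\<Sum>(R, x)\<in>(SIGMA R:Pow T. T - R). g (insert x R))"
    using assms by (subst sum.Sigma) auto
  also have "\<dots> = (\<Sum>(R, x)\<in>(SIGMA R:Pow T. R). g R)"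
    by (rule sum.reindex_bij_witness[where i = "\<lambda>(R, x). (R - {x}, x)" and j = "\<lambda>(R, x). (insert x R, x)"])
       (auto simp: insert_absorb)
  also have "\<dots> = (\<Sum>R\<in>Pow T. \<Sum>x\<in>R. g R)"
    using assms by (subst sum.Sigma) (auto intro: finite_subset)
  finally show ?thesis by simp
qed

text \<open>Splitting the subsets of \<open>insert x T\<close> by membership of \<open>x\<close>
  turns the sum into a combination of the values \<open>upsum V k f R\<close> with
  \<open>R \<subseteq> T\<close>. The recursion for \<open>c\<close> says precisely that the
  coefficient of each of these vanishes.\<close>

lemma harmonic_lift_sum_insert:
  assumes fin: "finite V" and T: "T \<subseteq> V" "card T + 1 = j"
    and c: "\<And>i. i < j \<Longrightarrow> c i * (real (card V) + 1 - real j - real i) + c (Suc i) * (real k - real i) = 0"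
  shows "(\<Sum>x\<in>V - T. harmonic_lift V k f c (insert x T)) = 0"
proof -
  let ?F = "upsum V k f"
  have finT: "finite T" using T fin finite_subset by blast
  have cins: "card (insert x R) = Suc (card R)" if "R \<in> Pow T" "x \<notin> R" for x R
    using that finT by (auto intro!: card_insert_disjoint intro: finite_subset)
  have "(\<Sum>x\<in>V - T. harmonic_lift V k f c (insert x T))
      = (\<Sum>x\<in>V - T. \<Sum>R\<in>Pow T. c (card R) * ?F R + c (Suc (card R)) * ?F (insert x R))"
    unfolding harmonic_lift_def
  proof (rule sum.cong[OF refl])
    fix x assume x: "x \<in> V - T"
    have "(\<Sum>R\<in>Pow (insert x T). c (card R) * ?F R)
        = (\<Sum>R\<in>Pow T. c (card R) * ?F R + c (card (insert x R)) * ?F (insert x R))"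
      using x finT by (intro sum_Pow_insert) auto
    also have "\<dots> = (\<Sum>R\<in>Pow T. c (card R) * ?F R + c (Suc (card R)) * ?F (insert x R))"
      using x by (intro sum.cong refl) (subst cins, auto)
    finally show "(\<Sum>R\<in>Pow (insert x T). c (card R) * ?F R)
        = (\<Sum>R\<in>Pow T. c (card R) * ?F R + c (Suc (card R)) * ?F (insert x R))" .
  qed
  also have "\<dots> = (\<Sum>R\<in>Pow T. \<Sum>x\<in>V - T. c (card R) * ?F R + c (Suc (card R)) * ?F (insert x R))"
    by (rule sum.swap)
  also have "\<dots> = (\<Sum>R\<in>Pow T. real (card (V - T)) * c (card R) * ?F R
      + c (Suc (card R)) * (\<Sum>x\<in>V - T. ?F (insert x R)))"
    by (simp add: sum.distrib sum_distrib_left mult.assoc)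
  \<comment> \<open>The sum over \<open>V - T\<close> is the sum over \<open>V - R\<close>, known
    from \<open>sum_upsum_insert\<close>, minus the sum over \<open>T - R\<close>, which the double
    counting turns into the term \<open>- card R\<close>.\<close>
  also have "\<dots> = (\<Sum>R\<in>Pow T. real (card (V - T)) * c (card R) * ?F R
      + c (Suc (card R)) * ((real k - real (card R)) * ?F R)
      - (\<Sum>x\<in>T - R. c (card (insert x R)) * ?F (insert x R)))"
  proof (intro sum.cong refl)
    fix R assume R: "R \<in> Pow T"
    have "(\<Sum>x\<in>V - R. ?F (insert x R)) = (\<Sum>x\<in>V - T. ?F (insert x R)) + (\<Sum>x\<in>T - R. ?F (insert x R))"
      using R T fin by (subst sum.union_disjoint[symmetric]) (auto intro!: sum.cong intro: finite_subset)
    moreover have "(\<Sum>x\<in>V - R. ?F (insert x R)) = (real k - real (card R)) * ?F R"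
      using R T fin by (intro sum_upsum_insert) auto
    ultimately have *: "(\<Sum>x\<in>V - T. ?F (insert x R))
        = (real k - real (card R)) * ?F R - (\<Sum>x\<in>T - R. ?F (insert x R))"
      by linarith
    have "(\<Sum>x\<in>T - R. c (card (insert x R)) * ?F (insert x R))
        = c (Suc (card R)) * (\<Sum>x\<in>T - R. ?F (insert x R))"
      using R cins unfolding sum_distrib_left by (intro sum.cong) auto
    then show "real (card (V - T)) * c (card R) * ?F R
        + c (Suc (card R)) * (\<Sum>x\<in>V - T. ?F (insert x R))
      = real (card (V - T)) * c (card R) * ?F R
        + c (Suc (card R)) * ((real k - real (card R)) * ?F R)
        - (\<Sum>x\<in>T - R. c (card (insert x R)) * ?F (insert x R))"
      unfolding * by (simp add: algebra_simps)
  qed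
  also have "\<dots> = (\<Sum>R\<in>Pow T. real (card (V - T)) * c (card R) * ?F R
      + c (Suc (card R)) * ((real k - real (card R)) * ?F R) - real (card R) * (c (card R) * ?F R))"
    unfolding sum_subtractf using sum_Pow_insert_inside[OF finT, of "\<lambda>R. c (card R) * ?F R"]
    by (simp add: mult.assoc)
  also have "\<dots> = (\<Sum>R\<in>Pow T. 0)"
  proof (intro sum.cong refl)
    fix R assume R: "R \<in> Pow T"
    have "card R < j" using R T finT card_mono[of T R] by auto
    from c[OF this] have *: "(c (card R) * (real (card V) + 1 - real j - real (card R))
        + c (Suc (card R)) * (real k - real (card R))) * ?F R = 0" by simp
    have card_diff: "real (card (V - T)) = real (card V) + 1 - real j"
      using T fin finT card_mono[of V T] by (simp add: card_Diff_subset of_nat_diff)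
    show "real (card (V - T)) * c (card R) * ?F R
      + c (Suc (card R)) * ((real k - real (card R)) * ?F R) - real (card R) * (c (card R) * ?F R) = 0"
      unfolding card_diff using * by (simp add: algebra_simps)
  qed
  finally show ?thesis by simp
qed

text \<open>Downward induction on \<open>card R\<close>. The hypothesis covers size
  \<open>j - 1\<close>, where the \<open>upsum\<close> of a \<open>j\<close>-set is \<open>h\<close>
  itself; below that, the sum over one-element extensions is zero and equals the nonzero factor
  \<open>j - card R\<close> times \<open>upsum V j h R\<close>.\<close>

lemma upsum_eq_0_below:
  assumes fin: "finite V" and top: "\<And>T. T \<subseteq> V \<Longrightarrow> card T + 1 = j \<Longrightarrow> (\<Sum>x\<in>V - T. h (insert x T)) = 0"
  shows "R \<subseteq> V \<Longrightarrow> card R < j \<Longrightarrow> upsum V j h R = 0"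
proof (induction "j - card R" arbitrary: R rule: less_induct)
  case less
  have finR: "finite R" using less.prems fin finite_subset by blast
  have "(\<Sum>x\<in>V - R. upsum V j h (insert x R)) = 0"
  proof (cases "card R + 1 = j")
    case True
    have "(\<Sum>x\<in>V - R. upsum V j h (insert x R)) = (\<Sum>x\<in>V - R. h (insert x R))"
      using True less.prems fin finR by (intro sum.cong refl upsum_top) (auto simp: layer_def)
    then show ?thesis using top[OF less.prems(1) True] by simp
  next
    case False
    then show ?thesis using less finR by (intro sum.neutral ballI less.hyps) auto
  qed
  then show ?case
    using sum_upsum_insert[OF fin less.prems(1), of j h] less.prems(2) by simp
qed

text \<open>The binomial coefficient counts the \<open>j\<close>-sets between \<open>R\<close> and a
  fixed \<open>k\<close>-set containing \<open>R\<close>.\<close>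

lemma upsum_upsum:
  assumes fin: "finite V" and "j \<le> k" and R: "R \<subseteq> V" "card R \<le> j"
  shows "upsum V j (upsum V k f) R = real ((k - card R) choose (j - card R)) * upsum V k f R"
proof -
  have finR: "finite R" using R fin finite_subset by blast
  have "upsum V j (upsum V k f) R
      = (\<Sum>T\<in>layer V j. \<Sum>A\<in>layer V k. if R \<subseteq> T \<and> T \<subseteq> A then f A else 0)"
    unfolding upsum_def by (intro sum.cong) auto
  also have "\<dots> = (\<Sum>A\<in>layer V k. \<Sum>T\<in>layer V j. if R \<subseteq> T \<and> T \<subseteq> A then f A else 0)"
    by (rule sum.swap)
  also have "\<dots> = (\<Sum>A\<in>layer V k. real ((k - card R) choose (j - card R)) * (if R \<subseteq> A then f A else 0))"
  proof (intro sum.cong refl)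
    fix A assume A: "A \<in> layer V k"
    then have A': "finite A" "A \<subseteq> V" "card A = k"
      using fin by (auto simp: layer_def intro: finite_subset)
    show "(\<Sum>T\<in>layer V j. if R \<subseteq> T \<and> T \<subseteq> A then f A else 0)
        = real ((k - card R) choose (j - card R)) * (if R \<subseteq> A then f A else 0)"
    proof (cases "R \<subseteq> A")
      case True
      have "(\<Sum>T\<in>layer V j. if R \<subseteq> T \<and> T \<subseteq> A then f A else 0)
          = (\<Sum>T\<in>{T. R \<subseteq> T \<and> T \<subseteq> A \<and> card T = j}. f A)"
        using A' fin by (intro sum.mono_neutral_cong_right) (auto simp: layer_def)
      also have "\<dots> = (\<Sum>T\<in>{T. T \<subseteq> A - R \<and> card T = j - card R}. f A)"
        using finR A' R(2) True
        by (intro sum.reindex_bij_witness[where i = "\<lambda>T. T \<union> R" and j = "\<lambda>T. T - R"])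
           (auto simp: card_Diff_subset card_Un_disjoint Int_Diff Diff_Int_distrib2 finite_subset
             intro!: card_Un_disjoint[THEN trans] intro: finite_subset)
      also have "\<dots> = real ((k - card R) choose (j - card R)) * f A"
        using A' True finR by (simp add: n_subsets card_Diff_subset)
      finally show ?thesis using True by simp
    next
      case False
      then have "(if R \<subseteq> T \<and> T \<subseteq> A then f A else 0) = 0" for T by simp (blast)
      then show ?thesis using False by (simp only: sum.neutral_const if_False mult_zero_right)
    qed
  qed
  also have "\<dots> = real ((k - card R) choose (j - card R)) * upsum V k f R"
    unfolding upsum_def by (simp add: sum_distrib_left)
  finally show ?thesis .
qed

text \<open>Adjointness: summing \<open>u\<close> over subsets is the transpose of
  \<open>upsum\<close>.\<close>

lemma sum_layer_lift:
  fixes g u :: "'a set \<Rightarrow> real"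
  assumes "finite V"
  shows "(\<Sum>T\<in>layer V j. g T * (\<Sum>R\<in>Pow T. u R)) = (\<Sum>i\<le>j. \<Sum>R\<in>layer V i. u R * upsum V j g R)"
proof -
  have "(\<Sum>T\<in>layer V j. g T * (\<Sum>R\<in>Pow T. u R))
      = (\<Sum>T\<in>layer V j. \<Sum>R\<in>Pow V. if R \<subseteq> T then u R * g T else 0)"
    unfolding sum_distrib_left using assms
    by (intro sum.cong refl sum.mono_neutral_cong_left) (auto simp: layer_def)
  also have "\<dots> = (\<Sum>R\<in>Pow V. \<Sum>T\<in>layer V j. if R \<subseteq> T then u R * g T else 0)"
    by (rule sum.swap)
  also have "\<dots> = (\<Sum>R\<in>Pow V. u R * upsum V j g R)"
    unfolding upsum_def sum_distrib_left by (intro sum.cong) auto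
  also have "\<dots> = (\<Sum>i\<le>j. \<Sum>R\<in>layer V i. u R * upsum V j g R)"
    using assms by (intro sum_Pow_layers) (auto simp: upsum_eq_0)
  finally show ?thesis .
qed

text \<open>The harmonic lift \<open>h\<close> is orthogonal to everything lifted from layers below
  \<open>j\<close>. As \<open>c j = 1\<close>, it differs from \<open>upsum V k f\<close> on
  \<open>j\<close>-sets only by such lifts, so its squared norm equals its inner product with
  \<open>upsum V k f\<close>, which \<open>upsum_upsum\<close> expresses by energies.\<close>

lemma energy_projection_nonneg:
  assumes fin: "finite V" and "j \<le> k" and cj: "c j = 1"
    and c: "\<And>i. i < j \<Longrightarrow> c i * (real (card V) + 1 - real j - real i) + c (Suc i) * (real k - real i) = 0"
  shows "0 \<le> (\<Sum>i\<le>j. c i * real ((k - i) choose (j - i)) * energy V k f i)"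
proof -
  let ?F = "upsum V k f" and ?h = "harmonic_lift V k f c"
  have zero: "upsum V j ?h R = 0" if "R \<subseteq> V" "card R < j" for R
    using upsum_eq_0_below[OF fin harmonic_lift_sum_insert[OF fin _ _ c]] that by blast
  have "0 \<le> (\<Sum>T\<in>layer V j. ?h T * ?h T)"
    by (intro sum_nonneg) auto
  also have "\<dots> = (\<Sum>i\<le>j. \<Sum>R\<in>layer V i. c (card R) * ?F R * upsum V j ?h R)"
    using sum_layer_lift[OF fin, where g = ?h and u = "\<lambda>R. c (card R) * ?F R"] by (simp add: harmonic_lift_def)
  \<comment> \<open>Orthogonality removes every layer except the top one.\<close>
  also have "\<dots> = (\<Sum>i\<le>j. if i = j then \<Sum>R\<in>layer V j. ?F R * ?h R else 0)"
    using zero cj by (intro sum.cong) (auto simp: layer_def upsum_top fin intro!: sum.neutral sum.cong)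
  also have "\<dots> = (\<Sum>T\<in>layer V j. ?F T * ?h T)"
    by simp
  also have "\<dots> = (\<Sum>i\<le>j. \<Sum>R\<in>layer V i. c (card R) * ?F R * upsum V j ?F R)"
    using sum_layer_lift[OF fin, where g = ?F and u = "\<lambda>R. c (card R) * ?F R"] by (simp add: harmonic_lift_def)
  also have "\<dots> = (\<Sum>i\<le>j. c i * real ((k - i) choose (j - i)) * energy V k f i)"
    unfolding energy_def sum_distrib_left
    using assms(2) by (intro sum.cong refl) (auto simp: layer_def upsum_upsum[OF fin] power2_eq_square)
  finally show ?thesis .
qed

section \<open>Explicit spectral inequalities for k = 3 and k = 4\<close>

lemma choose_2_real: "real (n choose 2) = real n * (real n - 1) / 2"
  by (simp add: binomial_gbinomial gbinomial_prod_rev eval_nat_numeral fact_numeral algebra_simps)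

lemma choose_3_real: "real (n choose 3) = real n * (real n - 1) * (real n - 2) / 6"
  by (simp add: binomial_gbinomial gbinomial_prod_rev eval_nat_numeral fact_numeral algebra_simps)

lemma choose_4_real: "real (n choose 4) = real n * (real n - 1) * (real n - 2) * (real n - 3) / 24"
  by (simp add: binomial_gbinomial gbinomial_prod_rev eval_nat_numeral fact_numeral algebra_simps)

lemma energy_0:
  assumes "finite V"
  shows "energy V k f 0 = (\<Sum>A\<in>layer V k. f A)\<^sup>2"
proof -
  have "layer V 0 = {{}}"
    using assms by (auto simp: layer_def dest: finite_subset)
  then show ?thesis
    by (simp add: energy_def upsum_def)
qed

lemma energy_top: "finite V \<Longrightarrow> energy V k f k = (\<Sum>A\<in>layer V k. (f A)\<^sup>2)"
  unfolding energy_def by (intro sum.cong refl) (simp add: upsum_top)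

lemma sum_atMost_numeral:
  fixes g :: "nat \<Rightarrow> real"
  shows "(\<Sum>i\<le>1. g i) = g 0 + g 1"
    and "(\<Sum>i\<le>2. g i) = g 0 + g 1 + g 2"
    and "(\<Sum>i\<le>3. g i) = g 0 + g 1 + g 2 + g 3"
    and "(\<Sum>i\<le>4. g i) = g 0 + g 1 + g 2 + g 3 + g 4"
  by (simp_all add: eval_nat_numeral)

text \<open>The cases \<open>j = 1, 2, 3, 4\<close>, with \<open>c\<close> found by solving the
  recursion downwards from \<open>c j = 1\<close>. The denominators are the numbers
  \<open>x + 1 - j - i\<close> with \<open>i < j\<close>; they are positive because
  \<open>x \<ge> 2 * K\<close> and \<open>j \<le> k\<close>.\<close>

lemma energy_projections:
  fixes f :: "'a set \<Rightarrow> real" and k :: nat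
  assumes fin: "finite V" and n: "card V \<ge> 2 * k"
  defines "x \<equiv> real (card V)" and "K \<equiv> real k" and "q \<equiv> energy V k f"
  shows "k \<ge> 1 \<Longrightarrow> 0 \<le> q 1 - K / x * real (k choose 1) * q 0"
    and "k \<ge> 2 \<Longrightarrow> 0 \<le> q 2 - (K - 1) / (x - 2) * real ((k - 1) choose 1) * q 1
      + (K - 1) * K / ((x - 2) * (x - 1)) * real (k choose 2) * q 0"
    and "k \<ge> 3 \<Longrightarrow> 0 \<le> q 3 - (K - 2) / (x - 4) * real ((k - 2) choose 1) * q 2
      + (K - 2) * (K - 1) / ((x - 4) * (x - 3)) * real ((k - 1) choose 2) * q 1
      - (K - 2) * (K - 1) * K / ((x - 4) * (x - 3) * (x - 2)) * real (k choose 3) * q 0"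
    and "k \<ge> 4 \<Longrightarrow> 0 \<le> q 4 - (K - 3) / (x - 6) * real ((k - 3) choose 1) * q 3
      + (K - 3) * (K - 2) / ((x - 6) * (x - 5)) * real ((k - 2) choose 2) * q 2
      - (K - 3) * (K - 2) * (K - 1) / ((x - 6) * (x - 5) * (x - 4)) * real ((k - 1) choose 3) * q 1
      + (K - 3) * (K - 2) * (K - 1) * K / ((x - 6) * (x - 5) * (x - 4) * (x - 3)) * real (k choose 4) * q 0"
proof -
  have x: "x \<ge> 2 * K" using n by (simp add: x_def K_def)
  show "0 \<le> q 1 - K / x * real (k choose 1) * q 0" if "k \<ge> 1"
  proof -
    define c where "c i = (if i = 0 then - K / x else 1)" for i :: nat
    have "c i * (x + 1 - real 1 - real i) + c (Suc i) * (real k - real i) = 0" if "i < 1" for i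
      using that \<open>k \<ge> 1\<close> x by (simp add: c_def K_def)
    from energy_projection_nonneg[OF fin \<open>k \<ge> 1\<close> _ this[unfolded x_def], of f]
    show ?thesis by (simp add: c_def q_def sum_atMost_numeral)
  qed
  show "0 \<le> q 2 - (K - 1) / (x - 2) * real ((k - 1) choose 1) * q 1
      + (K - 1) * K / ((x - 2) * (x - 1)) * real (k choose 2) * q 0" if "k \<ge> 2"
  proof -
    have "x \<ge> 4" using that x by (simp add: K_def)
    define c where "c i = (if i = 0 then (K - 1) * K / ((x - 2) * (x - 1)) else
      if i = 1 then - ((K - 1) / (x - 2)) else 1)" for i :: nat
    have "c i * (x + 1 - real 2 - real i) + c (Suc i) * (real k - real i) = 0" if "i < 2" for i
    proof -
      have "i = 0 \<or> i = 1" using that by auto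
      then show ?thesis using \<open>x \<ge> 4\<close> by (auto simp: c_def K_def[symmetric] divide_simps; algebra)
    qed
    from energy_projection_nonneg[OF fin \<open>k \<ge> 2\<close> _ this[unfolded x_def], of f]
    show ?thesis by (simp add: c_def q_def sum_atMost_numeral)
  qed
  show "0 \<le> q 3 - (K - 2) / (x - 4) * real ((k - 2) choose 1) * q 2
      + (K - 2) * (K - 1) / ((x - 4) * (x - 3)) * real ((k - 1) choose 2) * q 1
      - (K - 2) * (K - 1) * K / ((x - 4) * (x - 3) * (x - 2)) * real (k choose 3) * q 0" if "k \<ge> 3"
  proof -
    have "x \<ge> 6" using that x by (simp add: K_def)
    define c where "c i = (if i = 0 then - ((K - 2) * (K - 1) * K / ((x - 4) * (x - 3) * (x - 2))) else
      if i = 1 then (K - 2) * (K - 1) / ((x - 4) * (x - 3)) else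
      if i = 2 then - ((K - 2) / (x - 4)) else 1)" for i :: nat
    have "c i * (x + 1 - real 3 - real i) + c (Suc i) * (real k - real i) = 0" if "i < 3" for i
    proof -
      have "i = 0 \<or> i = 1 \<or> i = 2" using that by auto
      then show ?thesis using \<open>x \<ge> 6\<close> by (auto simp: c_def K_def[symmetric] divide_simps; algebra)
    qed
    from energy_projection_nonneg[OF fin \<open>k \<ge> 3\<close> _ this[unfolded x_def], of f]
    show ?thesis by (simp add: c_def q_def sum_atMost_numeral)
  qed
  show "0 \<le> q 4 - (K - 3) / (x - 6) * real ((k - 3) choose 1) * q 3
      + (K - 3) * (K - 2) / ((x - 6) * (x - 5)) * real ((k - 2) choose 2) * q 2
      - (K - 3) * (K - 2) * (K - 1) / ((x - 6) * (x - 5) * (x - 4)) * real ((k - 1) choose 3) * q 1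
      + (K - 3) * (K - 2) * (K - 1) * K / ((x - 6) * (x - 5) * (x - 4) * (x - 3)) * real (k choose 4) * q 0"
    if "k \<ge> 4"
  proof -
    have "x \<ge> 8" using that x by (simp add: K_def)
    define c where "c i = (if i = 0 then (K - 3) * (K - 2) * (K - 1) * K / ((x - 6) * (x - 5) * (x - 4) * (x - 3)) else
      if i = 1 then - ((K - 3) * (K - 2) * (K - 1) / ((x - 6) * (x - 5) * (x - 4))) else
      if i = 2 then (K - 3) * (K - 2) / ((x - 6) * (x - 5)) else
      if i = 3 then - ((K - 3) / (x - 6)) else 1)" for i :: nat
    have "c i * (x + 1 - real 4 - real i) + c (Suc i) * (real k - real i) = 0" if "i < 4" for i
    proof -
      have "i = 0 \<or> i = 1 \<or> i = 2 \<or> i = 3" using that by auto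
      then show ?thesis using \<open>x \<ge> 8\<close> by (auto simp: c_def K_def[symmetric] divide_simps; algebra)
    qed
    from energy_projection_nonneg[OF fin \<open>k \<ge> 4\<close> _ this[unfolded x_def], of f]
    show ?thesis by (simp add: c_def q_def sum_atMost_numeral)
  qed
qed

text \<open>
  The coefficients below are \<open>\<tau> = C(n-k-1, k-1)\<close>, where \<open>-\<tau>\<close> is the least eigenvalue, the second
  largest eigenvalue \<open>\<theta> = C(n-k-2, k-2)\<close>, \<open>(d + \<tau>) / N\<close> and \<open>(d - \<theta>) / N\<close>, where \<open>d = C(n-k, k)\<close>
  is the degree and \<open>N = C(n, k)\<close> the number of vertices.
\<close>

lemma kneser_3_spectral:
  fixes V :: "'a set" and f :: "'a set \<Rightarrow> real"
  assumes fin: "finite V" and n: "card V \<ge> 7"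
  defines "x \<equiv> real (card V)"
  defines "s \<equiv> (\<Sum>A\<in>layer V 3. f A)" and "w \<equiv> (\<Sum>A\<in>layer V 3. (f A)\<^sup>2)"
  shows "(x - 4) * (x - 5) / ((x - 1) * (x - 2)) * s\<^sup>2 \<le> kneser_form V 3 f + (x - 4) * (x - 5) / 2 * w"
    and "kneser_form V 3 f \<le> (x - 5) * w + (x - 5) * (x - 6) / (x * (x - 2)) * s\<^sup>2"
proof -
  have x: "x \<ge> 7" using n by (simp add: x_def)
  define q where "q = energy V 3 f"
  have form: "kneser_form V 3 f = q 0 - q 1 + q 2 - q 3"
    using kneser_form_energy[OF fin, of 3 f] by (simp add: q_def sum_atMost_numeral)
  have q: "s\<^sup>2 = q 0" "w = q 3"
    using fin by (simp_all add: q_def s_def w_def energy_0 energy_top)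
  have choose: "(3::nat) choose 2 = 3" "(3::nat) choose 3 = 1" "(2::nat) choose 2 = 1"
    by (simp_all add: eval_nat_numeral)
  \<comment> \<open>Up to positive factors, \<open>P1\<close>, \<open>P2\<close>, \<open>P3\<close>
    are the squared norms of the projections of \<open>f\<close> onto the nontrivial eigenspaces,
    and \<open>q 0\<close> is that of the constant part.\<close>
  define P1 where "P1 = q 1 - 9 / x * q 0"
  define P2 where "P2 = q 2 - 4 / (x - 2) * q 1 + 18 / ((x - 2) * (x - 1)) * q 0"
  define P3 where "P3 = q 3 - 1 / (x - 4) * q 2 + 2 / ((x - 4) * (x - 3)) * q 1
    - 6 / ((x - 4) * (x - 3) * (x - 2)) * q 0"
  have P: "0 \<le> P1" "0 \<le> P2" "0 \<le> P3"
    using energy_projections(1-3)[OF fin, of 3 f] n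
    by (simp_all add: P1_def P2_def P3_def q_def x_def choose)
  \<comment> \<open>Diagonalisation of the difference. The least eigenvalue belongs to the first
    eigenspace, so \<open>P1\<close> drops out, and the coefficient of \<open>s\<^sup>2\<close> is
    chosen to cancel the constant part. The eigenvalue on the third eigenspace is -1, whence the
    factor \<tau> - 1 of \<open>P3\<close>.\<close>
  have "kneser_form V 3 f + (x - 4) * (x - 5) / 2 * w - (x - 4) * (x - 5) / ((x - 1) * (x - 2)) * s\<^sup>2
      = ((x - 4) * (x - 5) / 2 - 1) * P3 + (x - 2) * (x - 5) / (2 * (x - 4)) * P2"
    unfolding form P2_def P3_def q using x
    by (simp add: divide_simps) algebra
  moreover have "(x - 4) * (x - 5) / 2 \<ge> 1"
    using mult_mono[of 3 "x - 4" 2 "x - 5"] x by simp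
  then have "0 \<le> ((x - 4) * (x - 5) / 2 - 1) * P3" "0 \<le> (x - 2) * (x - 5) / (2 * (x - 4)) * P2"
    using P x by simp_all
  ultimately show "(x - 4) * (x - 5) / ((x - 1) * (x - 2)) * s\<^sup>2
      \<le> kneser_form V 3 f + (x - 4) * (x - 5) / 2 * w"
    by linarith
  \<comment> \<open>Here \<open>P2\<close> drops out, since \<theta> is the eigenvalue on the second
    eigenspace.\<close>
  have "(x - 5) * w + (x - 5) * (x - 6) / (x * (x - 2)) * s\<^sup>2 - kneser_form V 3 f
      = (x - 4) * P3 + (x - 5) / (x - 3) * P1"
    unfolding form P1_def P3_def q using x
    by (simp add: divide_simps) algebra
  moreover have "0 \<le> (x - 4) * P3" "0 \<le> (x - 5) / (x - 3) * P1"
    using P x by simp_all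
  ultimately show "kneser_form V 3 f \<le> (x - 5) * w + (x - 5) * (x - 6) / (x * (x - 2)) * s\<^sup>2"
    by linarith
qed

lemma kneser_4_spectral:
  fixes V :: "'a set" and f :: "'a set \<Rightarrow> real"
  assumes fin: "finite V" and n: "card V \<ge> 9"
  defines "x \<equiv> real (card V)"
  defines "s \<equiv> (\<Sum>A\<in>layer V 4. f A)" and "w \<equiv> (\<Sum>A\<in>layer V 4. (f A)\<^sup>2)"
  shows "(x - 5) * (x - 6) * (x - 7) / ((x - 1) * (x - 2) * (x - 3)) * s\<^sup>2
      \<le> kneser_form V 4 f + (x - 5) * (x - 6) * (x - 7) / 6 * w"
    and "kneser_form V 4 f \<le> (x - 6) * (x - 7) / 2 * w
      + (x - 6) * (x - 7) * (x - 8) / (x * (x - 2) * (x - 3)) * s\<^sup>2"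
proof -
  have x: "x \<ge> 9" using n by (simp add: x_def)
  define q where "q = energy V 4 f"
  have form: "kneser_form V 4 f = q 0 - q 1 + q 2 - q 3 + q 4"
    using kneser_form_energy[OF fin, of 4 f] by (simp add: q_def sum_atMost_numeral)
  have q: "s\<^sup>2 = q 0" "w = q 4"
    using fin by (simp_all add: q_def s_def w_def energy_0 energy_top)
  have choose: "(4::nat) choose 2 = 6" "(4::nat) choose 3 = 4" "(4::nat) choose 4 = 1"
    "(3::nat) choose 2 = 3" "(3::nat) choose 3 = 1" "(2::nat) choose 2 = 1"
    by (simp_all add: eval_nat_numeral)
  define P1 where "P1 = q 1 - 16 / x * q 0"
  define P2 where "P2 = q 2 - 9 / (x - 2) * q 1 + 72 / ((x - 2) * (x - 1)) * q 0"
  define P3 where "P3 = q 3 - 4 / (x - 4) * q 2 + 18 / ((x - 4) * (x - 3)) * q 1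
    - 96 / ((x - 4) * (x - 3) * (x - 2)) * q 0"
  define P4 where "P4 = q 4 - 1 / (x - 6) * q 3 + 2 / ((x - 6) * (x - 5)) * q 2
    - 6 / ((x - 6) * (x - 5) * (x - 4)) * q 1 + 24 / ((x - 6) * (x - 5) * (x - 4) * (x - 3)) * q 0"
  have P: "0 \<le> P1" "0 \<le> P2" "0 \<le> P3" "0 \<le> P4"
    using energy_projections[OF fin, of 4 f] n
    by (simp_all add: P1_def P2_def P3_def P4_def q_def x_def choose)
  \<comment> \<open>The same diagonalisation; the eigenvalue on the top eigenspace is now +1, which
    gives \<open>P4\<close> the factor \<tau> + 1 here and \<theta> - 1 in the second bound.\<close>
  have "kneser_form V 4 f + (x - 5) * (x - 6) * (x - 7) / 6 * w
        - (x - 5) * (x - 6) * (x - 7) / ((x - 1) * (x - 2) * (x - 3)) * s\<^sup>2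
      = ((x - 5) * (x - 6) * (x - 7) / 6 + 1) * P4 + (x - 3) * (x - 7) * (x - 8) / (6 * (x - 6)) * P3
        + (x - 2) * (x - 6) * (x - 7) / (3 * (x - 4) * (x - 5)) * P2"
    unfolding form P2_def P3_def P4_def q using x
    by (simp add: divide_simps) algebra
  moreover have "0 \<le> ((x - 5) * (x - 6) * (x - 7) / 6 + 1) * P4"
      "0 \<le> (x - 3) * (x - 7) * (x - 8) / (6 * (x - 6)) * P3"
      "0 \<le> (x - 2) * (x - 6) * (x - 7) / (3 * (x - 4) * (x - 5)) * P2"
    using P x by simp_all
  ultimately show "(x - 5) * (x - 6) * (x - 7) / ((x - 1) * (x - 2) * (x - 3)) * s\<^sup>2
      \<le> kneser_form V 4 f + (x - 5) * (x - 6) * (x - 7) / 6 * w"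
    by linarith
  have "(x - 6) * (x - 7) / 2 \<ge> 1"
    using mult_mono[of 3 "x - 6" 2 "x - 7"] x by simp
  then have "0 \<le> ((x - 6) * (x - 7) / 2 - 1) * P4"
      "0 \<le> (x - 4) * (x - 7) / (2 * (x - 6)) * P3"
      "0 \<le> (x - 6) * (x - 7) / ((x - 4) * (x - 3)) * P1"
    using P x by simp_all
  moreover have "(x - 6) * (x - 7) / 2 * w
        + (x - 6) * (x - 7) * (x - 8) / (x * (x - 2) * (x - 3)) * s\<^sup>2 - kneser_form V 4 f
      = ((x - 6) * (x - 7) / 2 - 1) * P4 + (x - 4) * (x - 7) / (2 * (x - 6)) * P3
        + (x - 6) * (x - 7) / ((x - 4) * (x - 3)) * P1"
    unfolding form P1_def P3_def P4_def q using x
    by (simp add: divide_simps) algebra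
  ultimately show "kneser_form V 4 f \<le> (x - 6) * (x - 7) / 2 * w
      + (x - 6) * (x - 7) * (x - 8) / (x * (x - 2) * (x - 3)) * s\<^sup>2"
    by linarith
qed

section \<open>A weighted ratio bound for the components of a subgraph\<close>

text \<open>Ordered pairs: for symmetric loopless \<open>E\<close> every edge counts twice, as it
  does in the quadratic form.\<close>

definition adjacent_pairs :: "('a \<Rightarrow> 'a \<Rightarrow> bool) \<Rightarrow> 'a set \<Rightarrow> ('a \<times> 'a) set" where
  "adjacent_pairs E C = {(u, v) \<in> C \<times> C. E u v}"

definition adjacency_form :: "'a set \<Rightarrow> ('a \<Rightarrow> 'a \<Rightarrow> bool) \<Rightarrow> ('a \<Rightarrow> real) \<Rightarrow> real" where
  "adjacency_form V E f = (\<Sum>u\<in>V. \<Sum>v\<in>V. if E u v then f u * f v else 0)"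

section \<open>Connected components as equivalence classes\<close>

lemma equiv_conn_rel:
  assumes "symp E"
  shows "equiv V (conn_rel V E)"
proof -
  have "symp (\<lambda>a b. a \<in> V \<and> b \<in> V \<and> E a b)\<^sup>*\<^sup>*"
    using assms by (intro symp_rtranclp) (auto simp: symp_def)
  then show ?thesis
    unfolding conn_rel_def
    by (intro equivI refl_onI symI transI) (auto dest: sympD rtranclp_trans)
qed

lemma adjacent_in_conn_rel: "u \<in> V \<Longrightarrow> v \<in> V \<Longrightarrow> E u v \<Longrightarrow> (u, v) \<in> conn_rel V E"
  unfolding conn_rel_def by auto

lemma adjacent_same_component:
  assumes "symp E" "C \<in> V // conn_rel V E" "u \<in> C" "v \<in> V" "E u v"
  shows "v \<in> C"
proof -
  have eq: "equiv V (conn_rel V E)" using assms(1) by (rule equiv_conn_rel)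
  have "u \<in> V" using in_quotient_imp_subset[OF eq assms(2)] assms(3) by auto
  then have "(u, v) \<in> conn_rel V E" using assms by (intro adjacent_in_conn_rel)
  then show ?thesis using in_quotient_imp_closed[OF eq assms(2,3)] by blast
qed

lemma sum_over_components:
  fixes g :: "'a \<Rightarrow> real"
  assumes "symp E" "finite V"
  shows "(\<Sum>u\<in>V. g u) = (\<Sum>C\<in>V // conn_rel V E. \<Sum>u\<in>C. g u)"
proof -
  let ?R = "conn_rel V E"
  have eq: "equiv V ?R" using assms(1) by (rule equiv_conn_rel)
  have "(\<Sum>u\<in>V. g u) = (\<Sum>C\<in>V // ?R. \<Sum>u\<in>{u \<in> V. ?R `` {u} = C}. g u)"
    using assms(2) by (intro sum.group[symmetric]) (auto intro: quotientI simp: finite_quotient quotient_def)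
  also have "\<dots> = (\<Sum>C\<in>V // ?R. \<Sum>u\<in>C. g u)"
  proof (intro sum.cong refl)
    fix C assume C: "C \<in> V // ?R"
    then obtain w where w: "w \<in> V" "C = ?R `` {w}" by (rule quotientE)
    have "?R `` {u} = C \<and> u \<in> V \<longleftrightarrow> u \<in> C" for u
      unfolding w(2) Image_singleton_iff equiv_class_eq_iff[OF eq, of w u] using w(1) by (metis (full_types))
    then show "{u \<in> V. ?R `` {u} = C} = C" by blast
  qed
  finally show ?thesis .
qed

lemma component_finite_nonempty:
  assumes "symp E" "finite V" "C \<in> V // conn_rel V E"
  shows "C \<subseteq> V" "finite C" "C \<noteq> {}" "card C \<ge> 1"
proof -
  have eq: "equiv V (conn_rel V E)" using assms(1) by (rule equiv_conn_rel)
  show "C \<subseteq> V" using in_quotient_imp_subset[OF eq assms(3)] .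
  then show "finite C" using assms(2) finite_subset by blast
  show "C \<noteq> {}" using in_quotient_imp_non_empty[OF eq assms(3)] .
  then show "card C \<ge> 1" using \<open>finite C\<close> by (simp add: Suc_le_eq card_gt_0_iff)
qed

lemma num_components_independent:
  assumes "symp E" "independent_set V E I"
  shows "num_components I E = card I"
proof -
  have "\<not> E a b" if "a \<in> I" "b \<in> I" for a b
    using assms(2) that by (auto simp: independent_set_def)
  then have "x = y" if "(\<lambda>a b. a \<in> I \<and> b \<in> I \<and> E a b)\<^sup>*\<^sup>* x y" for x y
    using that by (auto elim: rtranclp.cases)
  then have "conn_rel I E = Id_on I"
    unfolding conn_rel_def by auto
  then have "I // conn_rel I E = (\<lambda>u. {u}) ` I"
    unfolding quotient_def by auto
  then show ?thesis
    unfolding num_components_def by (simp add: card_image)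
qed

text \<open>For a function that is constant on components and zero outside \<open>X\<close>, the
  adjacency form splits into one term per component. With the weights \<open>b\<close>, both the sum
  of \<open>f\<close> and the right-hand side of the spectral inequality equal the same number
  \<open>W\<close>, so the inequality reads \<open>a * W\<^sup>2 \<le> W\<close>.\<close>

lemma weighted_ratio_bound:
  fixes a t :: real
  assumes sym: "symp E" and fin: "finite V" and X: "X \<subseteq> V" and t: "t > 0" and a: "a > 0"
    and spectral: "\<And>f. a * (\<Sum>u\<in>V. f u)\<^sup>2 \<le> adjacency_form V E f + t * (\<Sum>u\<in>V. (f u)\<^sup>2)"
  shows "a * (\<Sum>C\<in>X // conn_rel X E. (real (card C))\<^sup>2 / (real (card (adjacent_pairs E C)) + t * real (card C))) \<le> 1"
proof -
  let ?R = "conn_rel X E"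
  let ?Q = "X // ?R"
  \<comment> \<open>the component weights that are optimal in the Cauchy-Schwarz inequality\<close>
  define b where "b C = real (card C) / (real (card (adjacent_pairs E C)) + t * real (card C))" for C
  define f where "f u = (if u \<in> X then b (?R `` {u}) else 0)" for u
  have finX: "finite X" using X fin finite_subset by blast
  have eq: "equiv X ?R" using sym by (rule equiv_conn_rel)
  have comp: "C \<subseteq> X" "finite C" "card C \<ge> 1" if "C \<in> ?Q" for C
    using component_finite_nonempty[OF sym finX that] by auto
  have f_eq: "f u = b C" if Cu: "C \<in> ?Q" "u \<in> C" for C u
  proof -
    obtain w where "w \<in> X" "C = ?R `` {w}" using Cu(1) by (rule quotientE)
    then have "?R `` {u} = C" using Cu(2) equiv_class_eq[OF eq, of w u] by simp
    then show ?thesis using Cu comp(1) by (auto simp: f_def)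
  qed
  have sum_f: "(\<Sum>u\<in>V. f u) = (\<Sum>C\<in>?Q. b C * real (card C))"
  proof -
    have "(\<Sum>u\<in>V. f u) = (\<Sum>u\<in>X. f u)"
      using X fin by (intro sum.mono_neutral_right) (auto simp: f_def)
    also have "\<dots> = (\<Sum>C\<in>?Q. \<Sum>u\<in>C. f u)"
      using sum_over_components[OF sym finX] .
    also have "\<dots> = (\<Sum>C\<in>?Q. b C * real (card C))"
      using f_eq by (intro sum.cong refl) simp
    finally show ?thesis .
  qed
  have sum_f2: "(\<Sum>u\<in>V. (f u)\<^sup>2) = (\<Sum>C\<in>?Q. (b C)\<^sup>2 * real (card C))"
  proof -
    have "(\<Sum>u\<in>V. (f u)\<^sup>2) = (\<Sum>u\<in>X. (f u)\<^sup>2)"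
      using X fin by (intro sum.mono_neutral_right) (auto simp: f_def)
    also have "\<dots> = (\<Sum>C\<in>?Q. \<Sum>u\<in>C. (f u)\<^sup>2)"
      using sum_over_components[OF sym finX] .
    also have "\<dots> = (\<Sum>C\<in>?Q. (b C)\<^sup>2 * real (card C))"
      using f_eq by (intro sum.cong refl) simp
    finally show ?thesis .
  qed
  have form: "adjacency_form V E f = (\<Sum>C\<in>?Q. (b C)\<^sup>2 * real (card (adjacent_pairs E C)))"
  proof -
    have "adjacency_form V E f = (\<Sum>u\<in>X. \<Sum>v\<in>V. if E u v then f u * f v else 0)"
      unfolding adjacency_form_def using X fin
      by (intro sum.mono_neutral_right) (auto simp: f_def intro!: sum.neutral)
    also have "\<dots> = (\<Sum>C\<in>?Q. \<Sum>u\<in>C. \<Sum>v\<in>V. if E u v then f u * f v else 0)"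
      using sum_over_components[OF sym finX] .
    also have "\<dots> = (\<Sum>C\<in>?Q. \<Sum>u\<in>C. \<Sum>v\<in>C. if E u v then (b C)\<^sup>2 else 0)"
    proof (rule sum.cong[OF refl], rule sum.cong[OF refl])
      fix C u assume C: "C \<in> ?Q" and u: "u \<in> C"
      \<comment> \<open>A neighbour of \<open>u\<close> outside \<open>C\<close> lies outside
        \<open>X\<close>, since otherwise it would belong to the component of
        \<open>u\<close>.\<close>
      have "f v = 0" if "v \<in> V - C" "E u v" for v
        using adjacent_same_component[OF sym C u _ that(2)] that(1) by (auto simp: f_def)
      then show "(\<Sum>v\<in>V. if E u v then f u * f v else 0) = (\<Sum>v\<in>C. if E u v then (b C)\<^sup>2 else 0)"
        using comp[OF C] X fin f_eq[OF C] u
        by (intro sum.mono_neutral_cong_right) (auto simp: power2_eq_square)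
    qed
    also have "\<dots> = (\<Sum>C\<in>?Q. (b C)\<^sup>2 * real (card (adjacent_pairs E C)))"
    proof (intro sum.cong refl)
      fix C assume C: "C \<in> ?Q"
      have "(\<Sum>u\<in>C. \<Sum>v\<in>C. if E u v then (b C)\<^sup>2 else 0)
          = (\<Sum>p\<in>C \<times> C. if p \<in> adjacent_pairs E C then (b C)\<^sup>2 else 0)"
        unfolding sum.cartesian_product by (intro sum.cong) (auto simp: adjacent_pairs_def split: if_splits)
      also have "\<dots> = (\<Sum>p\<in>adjacent_pairs E C. (b C)\<^sup>2)"
        using comp[OF C] by (intro sum.mono_neutral_cong_right) (auto simp: adjacent_pairs_def)
      finally show "(\<Sum>u\<in>C. \<Sum>v\<in>C. if E u v then (b C)\<^sup>2 else 0)
          = (b C)\<^sup>2 * real (card (adjacent_pairs E C))" by simp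
    qed
    finally show ?thesis .
  qed
  define W where "W = (\<Sum>C\<in>?Q. (real (card C))\<^sup>2 / (real (card (adjacent_pairs E C)) + t * real (card C)))"
  have W1: "W = (\<Sum>u\<in>V. f u)"
    unfolding sum_f W_def b_def by (simp add: power2_eq_square)
  have "adjacency_form V E f + t * (\<Sum>u\<in>V. (f u)\<^sup>2)
      = (\<Sum>C\<in>?Q. (b C)\<^sup>2 * (real (card (adjacent_pairs E C)) + t * real (card C)))"
    unfolding form sum_f2 sum_distrib_left sum.distrib[symmetric]
    by (intro sum.cong) (auto simp: algebra_simps)
  also have "\<dots> = W"
    unfolding W_def
  proof (intro sum.cong refl)
    fix C assume "C \<in> ?Q"
    then have "t * real (card C) > 0" using comp(3) t by force
    then have D: "real (card (adjacent_pairs E C)) + t * real (card C) \<noteq> 0" by linarith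
    have "(m / D)\<^sup>2 * D = m\<^sup>2 / D" if "D \<noteq> 0" for m D :: real
      using that by (simp add: power2_eq_square)
    from this[OF D] show "(b C)\<^sup>2 * (real (card (adjacent_pairs E C)) + t * real (card C))
        = (real (card C))\<^sup>2 / (real (card (adjacent_pairs E C)) + t * real (card C))"
      unfolding b_def .
  qed
  finally have "a * W\<^sup>2 \<le> W"
    using spectral[of f] W1 by simp
  then have "(a * W) * W \<le> 1 * W"
    by (simp add: power2_eq_square mult.assoc)
  \<comment> \<open>\<open>W\<close> can be cancelled only if it is positive; it is zero when
    \<open>X\<close> is empty.\<close>
  then have "W \<le> 0 \<or> a * W \<le> 1"
    by (simp only: mult_le_cancel_right) auto
  moreover have "a * W \<le> 0" if "W \<le> 0"
    using that a by (simp add: mult_nonneg_nonpos)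
  ultimately show ?thesis
    unfolding W_def[symmetric] by linarith
qed

text \<open>Each component contributes \<open>wt C\<close> to a total of at most
  \<open>card V\<close>. By \<open>single\<close> an isolated vertex contributes exactly
  \<open>1 + r\<close>, and by \<open>iso\<close> a larger component contributes more than
  \<open>card C + r\<close>; summation gives the bound, and equality leaves only isolated
  vertices.\<close>

lemma component_count_bound:
  fixes a t r :: real
  assumes sym: "symp E" and fin: "finite V" and X: "X \<subseteq> V" and t: "t > 0" and a: "a > 0"
    and spectral: "\<And>f. a * (\<Sum>u\<in>V. f u)\<^sup>2 \<le> adjacency_form V E f + t * (\<Sum>u\<in>V. (f u)\<^sup>2)"
    and single: "1 + r = a * real (card V) / t"
    and iso: "\<And>C. C \<in> X // conn_rel X E \<Longrightarrow> card C \<ge> 2 \<Longrightarrow>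
      (real (card C) + r) * (real (card (adjacent_pairs E C)) + t * real (card C))
        < a * real (card V) * (real (card C))\<^sup>2"
    and irrefl: "\<And>u. u \<in> V \<Longrightarrow> \<not> E u u"
  shows "real (card X) + r * real (num_components X E) \<le> real (card V)"
    and "real (card X) + r * real (num_components X E) = real (card V) \<Longrightarrow> independent_set V E X"
proof -
  let ?Q = "X // conn_rel X E"
  have finX: "finite X" using X fin finite_subset by blast
  have finQ: "finite ?Q" using finX by (intro finite_quotient) (auto simp: conn_rel_def)
  have comp: "C \<subseteq> X" "finite C" "card C \<ge> 1" if "C \<in> ?Q" for C
    using component_finite_nonempty[OF sym finX that] by auto
  define wt where "wt C = a * real (card V)
    * ((real (card C))\<^sup>2 / (real (card (adjacent_pairs E C)) + t * real (card C)))" for C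
  have small: "real (card C) + r \<le> wt C" if C: "C \<in> ?Q" "card C < 2" for C
  proof -
    have "card C = 1" using comp(3)[OF C(1)] C(2) by linarith
    then obtain u where "C = {u}" by (auto simp: card_1_singleton_iff)
    then have "adjacent_pairs E C = {}" using irrefl comp(1)[OF C(1)] X by (auto simp: adjacent_pairs_def)
    then show ?thesis using single t \<open>card C = 1\<close> by (simp add: wt_def)
  qed
  have large: "real (card C) + r < wt C" if C: "C \<in> ?Q" "card C \<ge> 2" for C
  proof -
    have "t * real (card C) > 0" using C(2) t by simp
    then have "real (card (adjacent_pairs E C)) + t * real (card C) > 0" by simp
    then show ?thesis using iso[OF C] by (simp add: wt_def field_simps)
  qed
  have le: "real (card C) + r \<le> wt C" if "C \<in> ?Q" for C
    using small[OF that] large[OF that] by linarith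
  have "(\<Sum>C\<in>?Q. wt C) = real (card V) * (a * (\<Sum>C\<in>?Q. (real (card C))\<^sup>2
      / (real (card (adjacent_pairs E C)) + t * real (card C))))"
    unfolding wt_def by (simp add: sum_distrib_left mult_ac)
  also have "\<dots> \<le> real (card V) * 1"
    using weighted_ratio_bound[OF sym fin X t a spectral] by (rule mult_left_mono) simp
  finally have wt: "(\<Sum>C\<in>?Q. wt C) \<le> real (card V)" by simp
  have total: "(\<Sum>C\<in>?Q. real (card C) + r) = real (card X) + r * real (num_components X E)"
    using sum_over_components[OF sym finX, of "\<lambda>_. 1"]
    by (simp add: sum.distrib num_components_def)
  show "real (card X) + r * real (num_components X E) \<le> real (card V)"
    using sum_mono[of ?Q "\<lambda>C. real (card C) + r" wt] le wt total by simp
  assume eq: "real (card X) + r * real (num_components X E) = real (card V)"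
  \<comment> \<open>One large component would make the summed inequality strict.\<close>
  have no_large: "card C < 2" if C: "C \<in> ?Q" for C
  proof (rule ccontr)
    assume "\<not> card C < 2"
    then have "(\<Sum>C\<in>?Q. real (card C) + r) < (\<Sum>C\<in>?Q. wt C)"
      using C le large[OF C] finQ by (intro sum_strict_mono_ex1) auto
    then show False using eq total wt by linarith
  qed
  show "independent_set V E X"
    unfolding independent_set_def
  proof (intro conjI X ballI notI)
    fix u v assume uv: "u \<in> X" "v \<in> X" "E u v"
    define C where "C = conn_rel X E `` {u}"
    have C: "C \<in> ?Q" unfolding C_def using uv(1) by (rule quotientI)
    have "u \<in> C" unfolding C_def using equiv_class_self[OF equiv_conn_rel[OF sym] uv(1)] .
    moreover have "v \<in> C" using adjacent_same_component[OF sym C \<open>u \<in> C\<close> uv(2,3)] .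
    moreover have "card C = 1" using no_large[OF C] comp(3)[OF C] by linarith
    ultimately have "u = v" by (auto simp: card_1_singleton_iff)
    then show False using uv irrefl X by auto
  qed
qed

text \<open>Hoffman's bound: on the indicator of an independent set the adjacency form vanishes, so
  the spectral inequality becomes \<open>a * m\<^sup>2 \<le> t * m\<close> with
  \<open>m = card I\<close>.\<close>

lemma ratio_bound:
  fixes a t :: real
  assumes fin: "finite V" and t: "t > 0" and a: "a > 0"
    and spectral: "\<And>f. a * (\<Sum>u\<in>V. f u)\<^sup>2 \<le> adjacency_form V E f + t * (\<Sum>u\<in>V. (f u)\<^sup>2)"
    and I: "independent_set V E I"
  shows "real (card I) \<le> t / a"
proof -
  define f where "f u = (if u \<in> I then 1 else 0 :: real)" for u
  have IV: "V \<inter> I = I" "finite I" using I fin by (auto simp: independent_set_def intro: finite_subset)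
  have "adjacency_form V E f = 0"
    unfolding adjacency_form_def using I
    by (intro sum.neutral ballI) (auto simp: f_def independent_set_def)
  moreover have "(\<Sum>u\<in>V. f u) = real (card I)" "(\<Sum>u\<in>V. (f u)\<^sup>2) = real (card I)"
    using fin IV by (simp_all add: f_def sum.inter_restrict[symmetric] if_distrib[of "\<lambda>x. x\<^sup>2"] cong: if_cong)
  ultimately have "a * (real (card I))\<^sup>2 \<le> t * real (card I)"
    using spectral[of f] by simp
  then have "(a * real (card I)) * real (card I) \<le> t * real (card I)"
    by (simp add: power2_eq_square mult.assoc)
  then have "card I = 0 \<or> a * real (card I) \<le> t"
    by (simp only: mult_le_cancel_right) auto
  then show ?thesis using t a by (auto simp: field_simps)
qed

section \<open>Edge boundaries in Kneser graphs\<close>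

text \<open>The right-hand side is concave in \<open>y\<close>, so a strict lower bound at both ends
  of an interval holds throughout. The identity in the proof is linear interpolation plus the
  nonnegative concavity defect.\<close>

lemma concave_quadratic_gt:
  fixes a b y K c D N T :: real
  assumes "a \<le> y" "y \<le> b" "D \<ge> 0" "K \<ge> 0"
    and "T < D * ((N - a) * (K * a + c))" "T < D * ((N - b) * (K * b + c))"
  shows "T < D * ((N - y) * (K * y + c))"
proof (cases "a = b")
  case False
  have "(b - a) * (D * ((N - y) * (K * y + c)) - T)
      = (b - y) * (D * ((N - a) * (K * a + c)) - T) + (y - a) * (D * ((N - b) * (K * b + c)) - T)
        + D * K * ((y - a) * ((b - y) * (b - a)))"
    by algebra
  moreover have "0 \<le> D * K * ((y - a) * ((b - y) * (b - a)))"
    using assms by simp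
  moreover have "0 < (b - y) * (D * ((N - a) * (K * a + c)) - T) + (y - a) * (D * ((N - b) * (K * b + c)) - T)"
  proof (cases "y = a")
    case True
    then show ?thesis using assms False by simp
  next
    case False
    then show ?thesis using assms by (intro add_nonneg_pos mult_nonneg_nonneg mult_pos_pos) auto
  qed
  ultimately have "0 < (b - a) * (D * ((N - y) * (K * y + c)) - T)" by linarith
  then show ?thesis using assms False by (simp add: zero_less_mult_iff)
qed (use assms in auto)

lemma mult_less_mult_Suc:
  fixes d p q :: real
  assumes "q < p" "0 < q" "0 \<le> d"
  shows "d * q < (d + 1) * p"
  using mult_left_mono[of q p d] assms by (simp add: distrib_right)

text \<open>In a \<open>d\<close>-regular graph \<open>d * y - e\<close> counts the edges leaving a
  set of size \<open>y\<close>, and the eigenvalue bound makes it at least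
  \<open>(d - h) * y * (N - y) / N\<close>. The conclusion is equivalent to
  \<open>x * d * y < (d * y - e) * (K * y + x - K)\<close>, so it reduces to the quadratic condition
  \<open>gt\<close>.\<close>

lemma edge_boundary_arith:
  fixes d h K N x y e :: real
  assumes "N > 0" "y > 0" "K * y + (x - K) > 0"
    and e: "e \<le> h * y + (d - h) / N * y\<^sup>2"
    and gt: "x * d * N < (d - h) * ((N - y) * (K * y + (x - K)))"
  shows "e * (K * y + x - K) < K * d * y * (y - 1)"
proof -
  let ?u = "K * y + (x - K)"
  have "N * ((d - h) / N * y\<^sup>2) = (d - h) * y\<^sup>2"
    using assms(1) by simp
  then have "N * e \<le> N * (h * y) + (d - h) * y\<^sup>2"
    using mult_left_mono[OF e, of N] assms(1) unfolding distrib_left by linarith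
  then have "(d - h) * (y * (N - y)) \<le> N * (d * y - e)"
    by (simp add: algebra_simps power2_eq_square)
  then have "(d - h) * (y * (N - y)) * ?u \<le> N * (d * y - e) * ?u"
    using assms(3) by (intro mult_right_mono) auto
  moreover have "x * d * N * y < (d - h) * ((N - y) * ?u) * y"
    using gt assms(2) by simp
  ultimately have "N * (x * d * y) < N * ((d * y - e) * ?u)"
    by (simp add: algebra_simps)
  then have "x * d * y < (d * y - e) * ?u"
    using assms(1) by simp
  then show ?thesis by (simp add: algebra_simps)
qed

lemma edge_boundary_small:
  fixes m e :: nat and d K x b :: real
  assumes "real e \<le> b" "b * (K * real m + x - K) < K * d * real m * (real m - 1)" "K * real m + x - K > 0"
  shows "real e * (K * real m + x - K) < K * d * real m * (real m - 1)"
  using mult_right_mono[of "real e" b "K * real m + x - K"] assms by linarith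

text \<open>
  With \<open>m\<close> the size of a component and \<open>e\<close> twice its number of edges, the second eigenvalue proves
  the next two bounds except at the ends of the range of \<open>m\<close>: small \<open>m\<close> use the trivial bound on \<open>e\<close>
  and the absence of triangles for \<open>n < 3k\<close>, and \<open>n = 7\<close>, \<open>m = 30\<close> needs that \<open>e\<close> is an integer.
\<close>

lemma edge_boundary_3:
  fixes n m e :: nat
  defines "x \<equiv> real n" and "d \<equiv> real ((n - 3) choose 3)"
  assumes n: "n \<ge> 7" and m: "m \<ge> 2" "m + ((n - 3) choose 3) + 1 \<le> n choose 3"
    and e: "e \<le> m * (m - 1)" "n < 9 \<Longrightarrow> m \<ge> 3 \<Longrightarrow> e + 2 \<le> m * (m - 1)"
    and spectral: "real e \<le> (x - 5) * real m + (x - 5) * (x - 6) / (x * (x - 2)) * (real m)\<^sup>2"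
  shows "real e * (3 * real m + x - 3) < 3 * d * real m * (real m - 1)"
proof -
  have x: "x \<ge> 7" using n by (simp add: x_def)
  define N where "N = real (n choose 3)"
  have N: "N = x * (x - 1) * (x - 2) / 6"
    by (simp add: N_def choose_3_real x_def)
  have d: "d = (x - 3) * (x - 4) * (x - 5) / 6"
    using n by (simp add: d_def choose_3_real x_def of_nat_diff algebra_simps)
  have dh: "d - (x - 5) = (x - 1) * (x - 5) * (x - 6) / 6"
    unfolding d by algebra
  have "N > 0" using x by (simp add: N)
  have spec: "real e \<le> (x - 5) * real m + (d - (x - 5)) / N * (real m)\<^sup>2"
  proof -
    have "(d - (x - 5)) / N = (x - 5) * (x - 6) / (x * (x - 2))"
      unfolding dh N using x by (simp add: divide_simps)
    then show ?thesis using spectral by simp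
  qed
  have mN: "real m \<le> N - d - 1"
    using m(2) by (simp add: N_def d_def flip: of_nat_add of_nat_Suc)
  \<comment> \<open>For \<open>n = 7\<close> the graph has 35 vertices and degree 4, so
    \<open>m\<close> is at most 30.\<close>
  consider "m = 2" | "n = 7" "m = 3" | "n = 7" "m = 30" | "n = 7" "m \<ge> 4" "m \<le> 29" | "n \<ge> 8" "m \<ge> 3"
    using n m mN N d by (cases "n = 7") (force simp: x_def)+
  then show ?thesis
  proof cases
    case 1
    \<comment> \<open>The claim for \<open>m = 2\<close>, \<open>e = 2\<close>, divided by
      2.\<close>
    have "x + 3 < 3 * d"
    proof -
      have "3 * 2 \<le> (x - 4) * (x - 5)" using x by (intro mult_mono) auto
      then have "(x - 3) * 6 \<le> (x - 3) * ((x - 4) * (x - 5))" using x by (intro mult_left_mono) auto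
      then have "x - 3 \<le> d" by (simp add: d mult.assoc)
      then show ?thesis using x by linarith
    qed
    then show ?thesis using 1 e(1) x by (intro edge_boundary_small[of e 2]) auto
  next
    case 2
    then show ?thesis using e(2) by (intro edge_boundary_small[of e 4]) (auto simp: d x_def)
  next
    case 3
    \<comment> \<open>The spectral estimate is \<open>60 + 360 / 7\<close>, which is too weak by
      itself. Rounding down to 111 suffices, since 111 * 94 = 10434 is below 10440.\<close>
    have "real e < 112" using spec 3 by (simp add: d N x_def)
    then show ?thesis using 3 by (intro edge_boundary_small[of e 111]) (auto simp: d x_def)
  next
    case 4
    have "x = 7" using 4 by (simp add: x_def)
    then have vals: "d = 4" "N = 35" by (simp_all add: d N)
    have "x * d * N < (d - (x - 5)) * ((N - real m) * (3 * real m + (x - 3)))"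
      using 4 by - (rule concave_quadratic_gt[of 4 _ 29]; (auto simp: vals \<open>x = 7\<close>))
    then show ?thesis using spec \<open>N > 0\<close> x m by (intro edge_boundary_arith) auto
  next
    case 5
    obtain t where t: "n = t + 8" using 5(1) by (metis add.commute le_Suc_ex)
    define s where "s = real t"
    have xs: "x = s + 8" and s: "s \<ge> 0" by (simp_all add: x_def t s_def)
    \<comment> \<open>Expanded at \<open>x = s + 8\<close>, the difference has only positive
      coefficients, which settles the lower endpoint for all \<open>s \<ge> 0\<close>.\<close>
    have "(d - (x - 5)) * ((N - 3) * (3 * 3 + (x - 3))) - x * d * N
        = 714 + 1810 * s + 2609/2 * s^2 + 1256/3 * s^3 + 202/3 * s^4 + 16/3 * s^5 + 1/6 * s^6"
      unfolding d N xs by algebra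
    moreover have "\<dots> > 0"
      using s by (intro add_pos_nonneg) auto
    ultimately have low: "x * d * N < (d - (x - 5)) * ((N - 3) * (3 * 3 + (x - 3)))" by linarith
    have Nd: "N - d - 1 = 3 * (x - 2) * (x - 3) / 2"
      unfolding d N by (simp add: field_simps power2_eq_square power3_eq_cube)
    have "(d - (x - 5)) * (3 * (N - d - 1) + (x - 3)) - x * N
        = 532 + 2119/2 * s + 2417/4 * s^2 + 601/4 * s^3 + 69/4 * s^4 + 3/4 * s^5"
      unfolding Nd dh unfolding N xs by (simp add: field_simps eval_nat_numeral)
    moreover have "\<dots> > 0"
      using s by (intro add_pos_nonneg) auto
    ultimately have "x * N < (d - (x - 5)) * (3 * (N - d - 1) + (x - 3))" by linarith
    moreover have "x * N > 0" using x \<open>N > 0\<close> by simp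
    moreover have "d \<ge> 0" by (simp add: d_def)
    \<comment> \<open>At the upper endpoint \<open>y = N - d - 1\<close> the factor
      \<open>N - y\<close> is \<open>d + 1\<close>, so comparing the cofactors of \<open>d\<close>
      and \<open>d + 1\<close> is enough.\<close>
    ultimately have "d * (x * N) < (d + 1) * ((d - (x - 5)) * (3 * (N - d - 1) + (x - 3)))"
      by - (rule mult_less_mult_Suc)
    then have up: "x * d * N < (d - (x - 5)) * ((N - (N - d - 1)) * (3 * (N - d - 1) + (x - 3)))"
      by (simp add: algebra_simps)
    have "d - (x - 5) \<ge> 0" unfolding dh using x by simp
    then have "x * d * N < (d - (x - 5)) * ((N - real m) * (3 * real m + (x - 3)))"
      using 5 mN low up by - (rule concave_quadratic_gt[of 3 _ "N - d - 1"]; auto)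
    then show ?thesis using spec \<open>N > 0\<close> x m by (intro edge_boundary_arith) auto
  qed
qed

lemma edge_boundary_4:
  fixes n m e :: nat
  defines "x \<equiv> real n" and "d \<equiv> real ((n - 4) choose 4)"
  assumes n: "n \<ge> 9" and m: "m \<ge> 2" "m + ((n - 4) choose 4) + 1 \<le> n choose 4"
    and e: "e \<le> m * (m - 1)" "n < 12 \<Longrightarrow> m \<ge> 3 \<Longrightarrow> e + 2 \<le> m * (m - 1)"
    and spectral: "real e \<le> (x - 6) * (x - 7) / 2 * real m
      + (x - 6) * (x - 7) * (x - 8) / (x * (x - 2) * (x - 3)) * (real m)\<^sup>2"
  shows "real e * (4 * real m + x - 4) < 4 * d * real m * (real m - 1)"
proof -
  have x: "x \<ge> 9" using n by (simp add: x_def)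
  define N where "N = real (n choose 4)"
  define h where "h = (x - 6) * (x - 7) / 2"
  have N: "N = x * (x - 1) * (x - 2) * (x - 3) / 24"
    by (simp add: N_def choose_4_real x_def)
  have d: "d = (x - 4) * (x - 5) * (x - 6) * (x - 7) / 24"
    using n by (simp add: d_def choose_4_real x_def of_nat_diff algebra_simps)
  have dh: "d - h = (x - 1) * (x - 6) * (x - 7) * (x - 8) / 24"
    unfolding d h_def by algebra
  have "N > 0" using x by (simp add: N)
  have spec: "real e \<le> h * real m + (d - h) / N * (real m)\<^sup>2"
  proof -
    have "(d - h) / N = (x - 6) * (x - 7) * (x - 8) / (x * (x - 2) * (x - 3))"
      unfolding dh N using x by (simp add: divide_simps)
    then show ?thesis using spectral by (simp add: h_def)
  qed
  have mN: "real m \<le> N - d - 1"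
    using m(2) by (simp add: N_def d_def flip: of_nat_add of_nat_Suc)
  \<comment> \<open>For \<open>n = 9\<close> there are 126 vertices and the degree is 5, so
    \<open>m\<close> is at most 120.\<close>
  consider "m = 2" | "n = 9" "m = 3" | "n = 9" "m = 4" | "n = 9" "m \<ge> 5" "m \<le> 120" | "n \<ge> 10" "m \<ge> 3"
    using n m mN N d by (cases "n = 9") (force simp: x_def)+
  then show ?thesis
  proof cases
    case 1
    have "x + 4 < 4 * d"
    proof -
      have "5 * 4 \<le> (x - 4) * (x - 5)" using x by (intro mult_mono) auto
      then have "(5 * 4) * 3 \<le> (x - 4) * (x - 5) * (x - 6)" using x by (intro mult_mono) auto
      then have "60 * (x - 7) \<le> (x - 4) * (x - 5) * (x - 6) * (x - 7)" using x by (intro mult_right_mono) auto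
      then have "5 * x - 35 \<le> 2 * d" by (simp add: d mult_ac)
      then show ?thesis using x by linarith
    qed
    then show ?thesis using 1 e(1) x by (intro edge_boundary_small[of e 2]) auto
  next
    case 2
    then show ?thesis using e(2) by (intro edge_boundary_small[of e 4]) (auto simp: d x_def)
  next
    case 3
    \<comment> \<open>A nonadjacent pair lowers the bound from 12 to 10: 10 * 21 is below 240,
      whereas 12 * 21 is not.\<close>
    then show ?thesis using e(2) by (intro edge_boundary_small[of e 10]) (auto simp: d x_def)
  next
    case 4
    have "x = 9" using 4 by (simp add: x_def)
    then have vals: "d = 5" "N = 126" "h = 3" by (simp_all add: d N h_def)
    have "x * d * N < (d - h) * ((N - real m) * (4 * real m + (x - 4)))"
      using 4 by - (rule concave_quadratic_gt[of 5 _ 120]; (auto simp: vals \<open>x = 9\<close>))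
    then show ?thesis using spec \<open>N > 0\<close> x m by (intro edge_boundary_arith) auto
  next
    case 5
    obtain t where t: "n = t + 10" using 5(1) by (metis add.commute le_Suc_ex)
    define s where "s = real t"
    have xs: "x = s + 10" and s: "s \<ge> 0" by (simp_all add: x_def t s_def)
    have "(d - h) * ((N - 3) * (4 * 3 + (x - 4))) - x * d * N
        = 2034 + 20099/2 * s + 40695/4 * s^2 + 335431/72 * s^3 + 168599/144 * s^4
          + 24845/144 * s^5 + 2147/144 * s^6 + 101/144 * s^7 + 1/72 * s^8"
      unfolding d N h_def xs by algebra
    moreover have "\<dots> > 0"
      using s by (intro add_pos_nonneg) auto
    ultimately have low: "x * d * N < (d - h) * ((N - 3) * (4 * 3 + (x - 4)))" by linarith
    have Nd: "N - d - 1 = (2 * x^3 - 21 * x^2 + 79 * x - 108) / 3"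
      unfolding d N by (simp add: field_simps power2_eq_square power3_eq_cube)
    have "(d - h) * (4 * (N - d - 1) + (x - 4)) - x * N
        = 4938 + 30923/3 * s + 22192/3 * s^2 + 24133/9 * s^3 + 551 * s^4 + 1175/18 * s^5
          + 25/6 * s^6 + 1/9 * s^7"
      unfolding Nd dh unfolding N xs by (simp add: field_simps eval_nat_numeral)
    moreover have "\<dots> > 0"
      using s by (intro add_pos_nonneg) auto
    ultimately have "x * N < (d - h) * (4 * (N - d - 1) + (x - 4))" by linarith
    moreover have "x * N > 0" using x \<open>N > 0\<close> by simp
    moreover have "d \<ge> 0" by (simp add: d_def)
    ultimately have "d * (x * N) < (d + 1) * ((d - h) * (4 * (N - d - 1) + (x - 4)))"
      by - (rule mult_less_mult_Suc)
    then have up: "x * d * N < (d - h) * ((N - (N - d - 1)) * (4 * (N - d - 1) + (x - 4)))"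
      by (simp add: algebra_simps)
    have "d - h \<ge> 0" unfolding dh using x by simp
    then have "x * d * N < (d - h) * ((N - real m) * (4 * real m + (x - 4)))"
      using 5 mN low up by - (rule concave_quadratic_gt[of 3 _ "N - d - 1"]; auto)
    then show ?thesis using spec \<open>N > 0\<close> x m by (intro edge_boundary_arith) auto
  qed
qed

section \<open>Toughness of Kneser graphs\<close>

lemma kneser_verts_layer: "kneser_verts n k = layer {1..n} k"
  unfolding kneser_verts_def layer_def ..

lemma finite_kneser_verts: "finite (kneser_verts n k)"
  unfolding kneser_verts_layer by (intro finite_layer) simp

lemma card_kneser_verts: "card (kneser_verts n k) = n choose k"
  unfolding kneser_verts_def by (simp add: n_subsets)

lemma symp_kneser_adj: "symp kneser_adj"
  unfolding symp_def kneser_adj_def by auto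

lemma kneser_form_adjacency: "kneser_form V k f = adjacency_form (layer V k) kneser_adj f"
  unfolding kneser_form_def adjacency_form_def kneser_adj_def ..

section \<open>Edge counts in induced subgraphs\<close>

lemma adjacency_form_indicator:
  assumes "finite V" "C \<subseteq> V"
  shows "adjacency_form V E (\<lambda>u. if u \<in> C then 1 else 0) = real (card (adjacent_pairs E C))"
proof -
  have "adjacency_form V E (\<lambda>u. if u \<in> C then 1 else 0)
      = (\<Sum>p\<in>V \<times> V. if p \<in> adjacent_pairs E C then 1 else 0)"
    unfolding adjacency_form_def sum.cartesian_product
    by (intro sum.cong) (auto simp: adjacent_pairs_def split: if_splits)
  also have "\<dots> = (\<Sum>p\<in>adjacent_pairs E C. 1)"
    using assms by (intro sum.mono_neutral_cong_right) (auto simp: adjacent_pairs_def)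
  finally show ?thesis by simp
qed

lemma card_adjacent_pairs_le:
  assumes "finite C" and irrefl: "\<And>u. \<not> E u u"
  shows "card (adjacent_pairs E C) \<le> card C * (card C - 1)"
proof -
  have "adjacent_pairs E C \<subseteq> C \<times> C - Id_on C"
    using irrefl by (auto simp: adjacent_pairs_def)
  then have "card (adjacent_pairs E C) \<le> card (C \<times> C - Id_on C)"
    using assms(1) by (intro card_mono) auto
  also have "\<dots> = card C * card C - card C"
  proof -
    have "Id_on C = (\<lambda>u. (u, u)) ` C" by auto
    then have "card (Id_on C) = card C" by (simp add: card_image inj_on_def)
    then show ?thesis
      using assms(1) by (subst card_Diff_subset) (auto simp: card_cartesian_product Id_on_def intro: finite_subset)
  qed
  finally show ?thesis by (simp add: diff_mult_distrib2)
qed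

text \<open>Joining \<open>u\<close> and \<open>v\<close> keeps the relation loopless and adds two
  ordered pairs, so the general bound applies to the enlarged relation.\<close>

lemma card_adjacent_pairs_nonadjacent:
  assumes "finite C" and irrefl: "\<And>u. \<not> E u u"
    and uv: "u \<in> C" "v \<in> C" "u \<noteq> v" "\<not> E u v" "\<not> E v u"
  shows "card (adjacent_pairs E C) + 2 \<le> card C * (card C - 1)"
proof -
  define E' where "E' a b \<longleftrightarrow> E a b \<or> (a = u \<and> b = v) \<or> (a = v \<and> b = u)" for a b
  have "adjacent_pairs E' C = insert (u, v) (insert (v, u) (adjacent_pairs E C))"
    using uv by (auto simp: adjacent_pairs_def E'_def)
  moreover have "finite (adjacent_pairs E C)"
    using assms(1) by (auto simp: adjacent_pairs_def intro: finite_subset[of _ "C \<times> C"])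
  moreover have "(u, v) \<notin> insert (v, u) (adjacent_pairs E C)" "(v, u) \<notin> adjacent_pairs E C"
    using uv by (auto simp: adjacent_pairs_def)
  ultimately have "card (adjacent_pairs E' C) = card (adjacent_pairs E C) + 2"
    by simp
  moreover have "card (adjacent_pairs E' C) \<le> card C * (card C - 1)"
    using assms by (intro card_adjacent_pairs_le) (auto simp: E'_def)
  ultimately show ?thesis by simp
qed

lemma kneser_triangle_free:
  assumes "n < 3 * k" "A \<in> kneser_verts n k" "B \<in> kneser_verts n k" "D \<in> kneser_verts n k"
    "kneser_adj A B" "kneser_adj A D"
  shows "\<not> kneser_adj B D"
proof
  assume "kneser_adj B D"
  have fin: "finite A" "finite B" "finite D"
    using assms(2-4) by (auto simp: kneser_verts_def intro: finite_subset)
  have "card (A \<union> (B \<union> D)) = card A + (card B + card D)"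
    using assms(5,6) \<open>kneser_adj B D\<close> fin by (subst card_Un_disjoint | force simp: kneser_adj_def)+
  then have "card (A \<union> (B \<union> D)) = 3 * k"
    using assms(2-4) by (simp add: kneser_verts_def)
  moreover have "card (A \<union> (B \<union> D)) \<le> card {1..n}"
    using assms(2-4) by (intro card_mono) (auto simp: kneser_verts_def)
  ultimately show False using assms(1) by simp
qed

lemma kneser_irrefl: "k \<ge> 1 \<Longrightarrow> A \<in> kneser_verts n k \<Longrightarrow> \<not> kneser_adj A A"
  unfolding kneser_adj_def kneser_verts_def by auto

lemma card_kneser_adjacent_pairs:
  assumes C: "C \<subseteq> kneser_verts n k" and k: "k \<ge> 1"
  shows "card (adjacent_pairs kneser_adj C) \<le> card C * (card C - 1)"
    and "n < 3 * k \<Longrightarrow> card C \<ge> 3 \<Longrightarrow> card (adjacent_pairs kneser_adj C) + 2 \<le> card C * (card C - 1)"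
proof -
  \<comment> \<open>Restricting to \<open>C\<close> makes the relation irreflexive everywhere;
    \<open>kneser_adj\<close> itself relates the empty set to itself.\<close>
  define E where "E A B \<longleftrightarrow> A \<in> C \<and> kneser_adj A B" for A B
  have pairs: "adjacent_pairs kneser_adj C = adjacent_pairs E C"
    by (auto simp: adjacent_pairs_def E_def)
  have irrefl: "\<not> E A A" for A
    using kneser_irrefl[OF k] C by (auto simp: E_def)
  have fin: "finite C" using C finite_kneser_verts finite_subset by blast
  show "card (adjacent_pairs kneser_adj C) \<le> card C * (card C - 1)"
    unfolding pairs using card_adjacent_pairs_le[OF fin irrefl] .
  assume n: "n < 3 * k" and "card C \<ge> 3"
  then obtain T where "T \<subseteq> C" "card T = 3" using obtain_subset_with_card_n by metis
  then obtain A B D where ABD: "A \<in> C" "B \<in> C" "D \<in> C" "A \<noteq> B" "A \<noteq> D" "B \<noteq> D"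
    by (auto simp: card_3_iff)
  have "\<exists>A\<in>C. \<exists>B\<in>C. A \<noteq> B \<and> \<not> kneser_adj A B"
    using kneser_triangle_free[OF n, of A B D] ABD C by blast
  then obtain A B where AB: "A \<in> C" "B \<in> C" "A \<noteq> B" "\<not> kneser_adj A B" by blast
  then have "\<not> E A B" "\<not> E B A" by (auto simp: E_def kneser_adj_def)
  then show "card (adjacent_pairs kneser_adj C) + 2 \<le> card C * (card C - 1)"
    unfolding pairs using fin irrefl AB by (intro card_adjacent_pairs_nonadjacent[of C E A B]) auto
qed

text \<open>On the indicator of \<open>C\<close> the Kneser form counts adjacent ordered pairs,
  while the sum and the sum of squares are both \<open>card C\<close>; the upper spectral bounds
  thus supply the hypothesis of the arithmetic lemmas.\<close>

lemma kneser_edge_boundary: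
  assumes k: "k \<in> {3, 4}" "n \<ge> 2 * k + 1"
    and C: "C \<subseteq> kneser_verts n k" "card C \<ge> 2" "card C + ((n - k) choose k) + 1 \<le> n choose k"
  shows "real (card (adjacent_pairs kneser_adj C)) * (real k * real (card C) + real n - real k)
    < real k * real ((n - k) choose k) * real (card C) * (real (card C) - 1)"
proof -
  let ?e = "card (adjacent_pairs kneser_adj C)"
  define f where "f A = (if A \<in> C then 1 else 0 :: real)" for A
  have inter: "layer {1..n} k \<inter> C = C" using C(1) by (auto simp: kneser_verts_layer)
  have fin: "finite (layer {1..n} k)" by (simp add: finite_layer)
  have form: "kneser_form {1..n} k f = real ?e"
    unfolding kneser_form_adjacency f_def using C(1) fin
    by (intro adjacency_form_indicator) (auto simp: kneser_verts_layer)
  have sums: "(\<Sum>A\<in>layer {1..n} k. f A) = real (card C)" "(\<Sum>A\<in>layer {1..n} k. (f A)\<^sup>2) = real (card C)"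
    using fin inter by (simp_all add: f_def sum.inter_restrict[symmetric] if_distrib[of "\<lambda>x. x\<^sup>2"] cong: if_cong)
  have "k \<ge> 1" using k by auto
  note pairs = card_kneser_adjacent_pairs[OF C(1) \<open>k \<ge> 1\<close>]
  from k(1) consider "k = 3" | "k = 4" by auto
  then show ?thesis
  proof cases
    case 1
    show ?thesis
      using edge_boundary_3[of n "card C" ?e] kneser_3_spectral(2)[of "{1..n}" f] form sums pairs k C
      by (simp add: 1)
  next
    case 2
    show ?thesis
      using edge_boundary_4[of n "card C" ?e] kneser_4_spectral(2)[of "{1..n}" f] form sums pairs k C
      by (simp add: 2)
  qed
qed

text \<open>Restates the lower spectral bounds uniformly in \<open>k\<close>, with \<open>t\<close>
  = \<tau>. The relation \<open>real k * d = (real n - real k) * t\<close> says that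
  \<open>d / t\<close> is the claimed toughness.\<close>

lemma kneser_least_eigenvalue:
  assumes k: "k \<in> {3, 4}" "n \<ge> 2 * k + 1"
  defines "t \<equiv> real ((n - k - 1) choose (k - 1))" and "d \<equiv> real ((n - k) choose k)"
  shows "(d + t) / real (n choose k) * (\<Sum>A\<in>kneser_verts n k. f A)\<^sup>2
      \<le> adjacency_form (kneser_verts n k) kneser_adj f + t * (\<Sum>A\<in>kneser_verts n k. (f A)\<^sup>2)"
    and "real k * d = (real n - real k) * t" and "t > 0"
proof -
  define x where "x = real n"
  from k(1) consider "k = 3" | "k = 4" by auto
  then have "(d + t) / real (n choose k) * (\<Sum>A\<in>kneser_verts n k. f A)\<^sup>2
      \<le> adjacency_form (kneser_verts n k) kneser_adj f + t * (\<Sum>A\<in>kneser_verts n k. (f A)\<^sup>2)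
    \<and> real k * d = (real n - real k) * t"
  proof cases
    case 1
    have x: "x \<ge> 7" using k 1 by (simp add: x_def)
    have t: "t = (x - 4) * (x - 5) / 2" and d: "d = (x - 3) * (x - 4) * (x - 5) / 6"
    proof -
      have sub: "real (n - 4) = x - 4" "real (n - 3) = x - 3"
        using k(2) 1 by (simp_all add: x_def of_nat_diff)
      show "t = (x - 4) * (x - 5) / 2" "d = (x - 3) * (x - 4) * (x - 5) / 6"
        by (simp_all add: t_def d_def 1 choose_2_real choose_3_real sub)
    qed
    have co: "(d + t) / real (n choose k) = (x - 4) * (x - 5) / ((x - 1) * (x - 2))"
    proof -
      have "d + t = x * ((x - 4) * (x - 5)) / 6" unfolding d t by (simp add: field_simps)
      then show ?thesis using x 1 by (simp add: choose_3_real x_def[symmetric] divide_simps)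
    qed
    have kd: "real k * d = (real n - real k) * t"
      unfolding d t by (simp add: 1 x_def)
    have "(x - 4) * (x - 5) / ((x - 1) * (x - 2)) * (\<Sum>A\<in>kneser_verts n k. f A)\<^sup>2
        \<le> adjacency_form (kneser_verts n k) kneser_adj f
          + (x - 4) * (x - 5) / 2 * (\<Sum>A\<in>kneser_verts n k. (f A)\<^sup>2)"
      using kneser_3_spectral(1)[of "{1..n}" f] k 1
      by (simp add: x_def kneser_verts_layer kneser_form_adjacency)
    then show ?thesis
      unfolding co t[symmetric] using kd by blast
  next
    case 2
    have x: "x \<ge> 9" using k 2 by (simp add: x_def)
    have t: "t = (x - 5) * (x - 6) * (x - 7) / 6" and d: "d = (x - 4) * (x - 5) * (x - 6) * (x - 7) / 24"
    proof -
      have sub: "real (n - 5) = x - 5" "real (n - 4) = x - 4"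
        using k(2) 2 by (simp_all add: x_def of_nat_diff)
      show "t = (x - 5) * (x - 6) * (x - 7) / 6" "d = (x - 4) * (x - 5) * (x - 6) * (x - 7) / 24"
        by (simp_all add: t_def d_def 2 choose_3_real choose_4_real sub)
    qed
    have co: "(d + t) / real (n choose k) = (x - 5) * (x - 6) * (x - 7) / ((x - 1) * (x - 2) * (x - 3))"
    proof -
      have "d + t = x * ((x - 5) * (x - 6) * (x - 7)) / 24" unfolding d t by (simp add: field_simps)
      then show ?thesis using x 2 by (simp add: choose_4_real x_def[symmetric] divide_simps)
    qed
    have kd: "real k * d = (real n - real k) * t"
      unfolding d t by (simp add: 2 x_def)
    have "(x - 5) * (x - 6) * (x - 7) / ((x - 1) * (x - 2) * (x - 3)) * (\<Sum>A\<in>kneser_verts n k. f A)\<^sup>2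
        \<le> adjacency_form (kneser_verts n k) kneser_adj f
          + (x - 5) * (x - 6) * (x - 7) / 6 * (\<Sum>A\<in>kneser_verts n k. (f A)\<^sup>2)"
      using kneser_4_spectral(1)[of "{1..n}" f] k 2
      by (simp add: x_def kneser_verts_layer kneser_form_adjacency)
    then show ?thesis
      unfolding co t[symmetric] using kd by blast
  qed
  then show "(d + t) / real (n choose k) * (\<Sum>A\<in>kneser_verts n k. f A)\<^sup>2
      \<le> adjacency_form (kneser_verts n k) kneser_adj f + t * (\<Sum>A\<in>kneser_verts n k. (f A)\<^sup>2)"
    and "real k * d = (real n - real k) * t"
    by auto
  show "t > 0" unfolding t_def using k by (auto simp: zero_less_binomial_iff)
qed

text \<open>Pick a vertex \<open>W\<close> of another component. Then \<open>C\<close> avoids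
  \<open>W\<close> and all its neighbours in the whole Kneser graph, that is, one vertex and
  \<open>(n - k) choose k\<close> more.\<close>

lemma card_kneser_component_le:
  assumes X: "X \<subseteq> kneser_verts n k" and k: "k \<ge> 1"
    and two: "num_components X kneser_adj \<ge> 2" and C: "C \<in> X // conn_rel X kneser_adj"
  shows "card C + ((n - k) choose k) + 1 \<le> n choose k"
proof -
  let ?V = "kneser_verts n k" and ?Q = "X // conn_rel X kneser_adj"
  have finX: "finite X" using X finite_kneser_verts finite_subset by blast
  have "\<not> ?Q \<subseteq> {C}"
    using two card_mono[of "{C}" ?Q] by (auto simp: num_components_def)
  then obtain C' where C': "C' \<in> ?Q" "C' \<noteq> C" by auto
  obtain W where W: "W \<in> C'" using component_finite_nonempty[OF symp_kneser_adj finX C'(1)] by blast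
  have WX: "W \<in> X" and CX: "C \<subseteq> X" "finite C"
    using component_finite_nonempty[OF symp_kneser_adj finX] C' C W by auto
  have WC: "W \<notin> C"
    using quotient_disj[OF equiv_conn_rel[OF symp_kneser_adj] C C'(1)] C' W by blast
  define nbrs where "nbrs = {B. B \<subseteq> {1..n} - W \<and> card B = k}"
  have W': "W \<subseteq> {1..n}" "card W = k" using WX X by (auto simp: kneser_verts_def)
  have card_nbrs: "card nbrs = (n - k) choose k"
    unfolding nbrs_def using W' by (subst n_subsets) (auto simp: card_Diff_subset finite_subset)
  have disj: "C \<inter> insert W nbrs = {}"
    using adjacent_same_component[OF symp_kneser_adj C _ WX] WC
    by (auto simp: nbrs_def kneser_adj_def)
  have "W \<noteq> {}" using k W' by auto
  then have "W \<notin> nbrs" by (auto simp: nbrs_def)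
  have "finite nbrs" by (simp add: nbrs_def)
  have "card (C \<union> insert W nbrs) = card C + (((n - k) choose k) + 1)"
    using disj \<open>W \<notin> nbrs\<close> \<open>finite nbrs\<close> CX card_nbrs by (subst card_Un_disjoint) auto
  moreover have "card (C \<union> insert W nbrs) \<le> card ?V"
    using CX X WX finite_kneser_verts by (intro card_mono) (auto simp: nbrs_def kneser_verts_def)
  ultimately show ?thesis by (simp add: card_kneser_verts)
qed

lemma kneser_cut_bound:
  assumes k: "k \<in> {3, 4}" "n \<ge> 2 * k + 1" and S: "is_vertex_cut (kneser_verts n k) kneser_adj S"
  defines "c \<equiv> real (num_components (kneser_verts n k - S) kneser_adj)"
  shows "(real n / real k - 1) * c \<le> real (card S)"
    and "(real n / real k - 1) * c = real (card S) \<Longrightarrow>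
      maximum_independent_set (kneser_verts n k) kneser_adj (kneser_verts n k - S)"
proof -
  let ?V = "kneser_verts n k"
  define X where "X = ?V - S"
  define t where "t = real ((n - k - 1) choose (k - 1))"
  define d where "d = real ((n - k) choose k)"
  define N where "N = real (n choose k)"
  define r where "r = real n / real k - 1"
  define a where "a = (d + t) / N"
  have k1: "k \<ge> 1" using k by auto
  have r: "r \<ge> 0" using k k1 by (simp add: r_def field_simps)
  have kr: "real k * r = real n - real k" using k1 by (simp add: r_def right_diff_distrib)
  have eig: "a * (\<Sum>A\<in>?V. f A)\<^sup>2 \<le> adjacency_form ?V kneser_adj f + t * (\<Sum>A\<in>?V. (f A)\<^sup>2)" for f
    using kneser_least_eigenvalue(1)[OF k] by (simp add: a_def t_def d_def N_def)
  have kd: "real k * d = (real n - real k) * t" and t: "t > 0"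
    using kneser_least_eigenvalue(2,3)[OF k] by (simp_all add: t_def d_def)
  have d: "d = r * t" using kd k1 by (simp add: r_def field_simps)
  have N: "N > 0" using k by (auto simp: N_def zero_less_binomial_iff)
  have a: "a > 0" using d t r N by (simp add: a_def add_nonneg_pos)
  have "a * N = d + t" using N by (simp add: a_def)
  then have aN: "a * N = (1 + r) * t" by (simp add: d distrib_right)
  have cardV: "real (card ?V) = N" by (simp add: card_kneser_verts N_def)
  have XV: "X \<subseteq> ?V" by (auto simp: X_def)
  have two: "num_components X kneser_adj \<ge> 2" and SV: "S \<subseteq> ?V"
    using S by (auto simp: is_vertex_cut_def X_def)
  have cardX: "real (card X) = N - real (card S)"
  proof -
    have "card X = card ?V - card S"
      unfolding X_def using SV finite_subset[OF SV finite_kneser_verts] by (intro card_Diff_subset)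
    moreover have "card S \<le> card ?V"
      using SV finite_kneser_verts by (intro card_mono)
    ultimately show ?thesis using cardV by (simp add: of_nat_diff)
  qed
  have single: "1 + r = a * real (card ?V) / t" using aN t cardV by simp
  have iso: "(real (card C) + r) * (real (card (adjacent_pairs kneser_adj C)) + t * real (card C))
      < a * real (card ?V) * (real (card C))\<^sup>2"
    if C: "C \<in> X // conn_rel X kneser_adj" "card C \<ge> 2" for C
  proof -
    have "finite X" using XV finite_kneser_verts finite_subset by blast
    then have "C \<subseteq> ?V"
      using component_finite_nonempty(1)[OF symp_kneser_adj _ C(1)] XV by blast
    note bound = kneser_edge_boundary[OF k this C(2) card_kneser_component_le[OF XV k1 two C(1)]]
    define m where "m = real (card C)"
    define e where "e = real (card (adjacent_pairs kneser_adj C))"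
    have "e * (real k * m + real n - real k) < real k * d * m * (m - 1)"
      using bound by (simp add: m_def e_def d_def)
    moreover have "real k * (e * (m + r)) = e * (real k * m + real k * r)"
      by (simp add: algebra_simps)
    ultimately have "real k * (e * (m + r)) < real k * (d * m * (m - 1))"
      unfolding kr by (simp add: algebra_simps)
    then have "e * (m + r) < d * m * (m - 1)" using k1 by simp
    \<comment> \<open>With \<open>d = r * t\<close>, adding \<open>t * m * (m + r)\<close> to both
      sides yields exactly the form needed by \<open>component_count_bound\<close>.\<close>
    then have "(m + r) * (e + t * m) < (1 + r) * t * m\<^sup>2"
      unfolding d by (simp add: algebra_simps power2_eq_square)
    then show ?thesis using aN cardV by (simp add: m_def e_def)
  qed
  have irrefl: "\<not> kneser_adj A A" if "A \<in> ?V" for A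
    using kneser_irrefl[OF k1 that] .
  note bound = component_count_bound[OF symp_kneser_adj finite_kneser_verts XV t a eig single iso irrefl]
  have cX: "c = real (num_components X kneser_adj)" by (simp add: c_def X_def)
  show "(real n / real k - 1) * c \<le> real (card S)"
    using bound(1) cardX cardV cX by (simp add: r_def)
  assume "(real n / real k - 1) * c = real (card S)"
  then have tight: "r * c = real (card S)" by (simp add: r_def)
  have ind: "independent_set ?V kneser_adj X"
    using bound(2) tight cardX cardV cX by simp
  \<comment> \<open>An independent \<open>X\<close> has \<open>card X\<close> components, so
    tightness fixes \<open>card X\<close> at \<open>N / (1 + r)\<close>. This is the ratio bound
    \<open>t / a\<close>, hence no independent set is larger.\<close>
  have "r * real (card X) = real (card S)"
    using tight num_components_independent[OF symp_kneser_adj ind] cX by simp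
  then have "(1 + r) * real (card X) = N"
    using cardX by (simp add: distrib_right)
  then have "real (card X) = N / (1 + r)"
    using r by (simp add: field_simps)
  also have "\<dots> = t / a"
    using aN a t r by (simp add: field_simps)
  finally have cardX_eq: "real (card X) = t / a" .
  have "card J \<le> card X" if "independent_set ?V kneser_adj J" for J
    using ratio_bound[OF finite_kneser_verts t a eig that] cardX_eq by simp
  then show "maximum_independent_set ?V kneser_adj (?V - S)"
    using ind by (simp add: maximum_independent_set_def X_def)
qed

text \<open>What remains is the star of all \<open>k\<close>-sets containing 1. It is independent,
  so each of its \<open>(n - 1) choose (k - 1)\<close> vertices is a component, while
  \<open>S\<close> has \<open>(n - 1) choose k\<close> elements.\<close>

lemma kneser_star_cut:
  assumes "k \<ge> 2" "n \<ge> 2 * k + 1"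
  defines "S \<equiv> kneser_verts n k \<inter> {A. 1 \<notin> A}"
  shows "is_vertex_cut (kneser_verts n k) kneser_adj S"
    and "real (card S) / real (num_components (kneser_verts n k - S) kneser_adj) = real n / real k - 1"
proof -
  let ?V = "kneser_verts n k"
  define X where "X = ?V - S"
  have "independent_set ?V kneser_adj X"
    by (auto simp: independent_set_def kneser_adj_def X_def S_def)
  then have comps: "num_components X kneser_adj = card X"
    using num_components_independent symp_kneser_adj by blast
  have "S = {A. A \<subseteq> {2..n} \<and> card A = k}"
  proof -
    have "A \<subseteq> {1..n} \<and> 1 \<notin> A \<longleftrightarrow> A \<subseteq> {2..n}" for A
      by (auto simp: subset_eq) (metis Suc_1 Suc_leI le_neq_implies_less One_nat_def)
    then show ?thesis unfolding S_def kneser_verts_def by blast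
  qed
  then have cardS: "card S = (n - 1) choose k" by (simp add: n_subsets)
  have "card X = (n choose k) - card S"
    unfolding X_def card_kneser_verts[symmetric] S_def using finite_kneser_verts
    by (intro card_Diff_subset) auto
  moreover obtain n' k' where nk: "n = Suc n'" "k = Suc k'"
    using assms(1,2) by (cases n; cases k) auto
  ultimately have cardX: "card X = n' choose k'" using cardS by simp
  have k': "1 \<le> k'" "k' < n'" using assms(1,2) nk by auto
  have "2 \<le> n' choose k'"
  proof -
    obtain n'' k'' where "n' = Suc n''" "k' = Suc k''"
      using k' by (cases n'; cases k') auto
    moreover have "n'' choose k'' > 0" "n'' choose Suc k'' > 0"
      using calculation k' by (simp_all add: zero_less_binomial_iff)
    ultimately show ?thesis by (simp del: zero_less_binomial_iff)
  qed
  then show "is_vertex_cut ?V kneser_adj S"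
    using comps cardX by (auto simp: is_vertex_cut_def X_def S_def)
  have absorb: "real k * real (n' choose k) = (real n - real k) * real (n' choose k')"
  proof -
    \<comment> \<open>Both sides equal \<open>n'\<close> times \<open>(n' - 1) choose k'\<close>, by
      the two absorption identities.\<close>
    have "k * (n' choose k) = (n' - k') * (n' choose k')"
      using binomial_absorption[of k' n'] binomial_absorb_comp[of n' k'] nk by simp
    then have "real k * real (n' choose k) = real (n' - k') * real (n' choose k')"
      by (simp flip: of_nat_mult)
    then show ?thesis using k' nk by (simp add: of_nat_diff)
  qed
  show "real (card S) / real (num_components (?V - S) kneser_adj) = real n / real k - 1"
  proof -
    have "real k * real (card S) = (real n - real k) * real (card X)"
      using absorb cardS cardX nk by simp
    moreover have "real (card X) > 0" "real k > 0" using cardX \<open>2 \<le> n' choose k'\<close> nk k' by auto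
    ultimately show ?thesis
      unfolding X_def[symmetric] comps by (simp add: field_simps)
  qed
qed

theorem theorem1p2:
  fixes n k :: nat
  assumes "k \<in> {3, 4}" and "n \<ge> 2 * k + 1"
  shows "toughness (kneser_verts n k) kneser_adj = real n / real k - 1
         \<and> (\<forall>S. is_vertex_cut (kneser_verts n k) kneser_adj S \<and>
               toughness (kneser_verts n k) kneser_adj =
                 real (card S) / real (num_components (kneser_verts n k - S) kneser_adj)
             \<longrightarrow> (\<exists>I. maximum_independent_set (kneser_verts n k) kneser_adj I \<and>
                      S = kneser_verts n k - I))"
proof -
  let ?V = "kneser_verts n k"
  let ?q = "\<lambda>S. real (card S) / real (num_components (?V - S) kneser_adj)"
  have pos: "real (num_components (?V - S) kneser_adj) > 0" if "is_vertex_cut ?V kneser_adj S" for S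
    using that by (simp add: is_vertex_cut_def)
  have set_eq: "{?q S | S. is_vertex_cut ?V kneser_adj S} = ?q ` {S. is_vertex_cut ?V kneser_adj S}"
    by auto
  have "finite {S. is_vertex_cut ?V kneser_adj S}"
    by (rule finite_subset[of _ "Pow ?V"]) (auto simp: is_vertex_cut_def finite_kneser_verts)
  then have fin: "finite {?q S | S. is_vertex_cut ?V kneser_adj S}"
    unfolding set_eq by simp
  have "k \<ge> 2" using assms by auto
  \<comment> \<open>The star cut attains the value, and the cut bound shows that it is
    minimal.\<close>
  have tough: "toughness ?V kneser_adj = real n / real k - 1"
    unfolding toughness_def
  proof (intro Min_eqI fin)
    show "real n / real k - 1 \<in> {?q S | S. is_vertex_cut ?V kneser_adj S}"
      using kneser_star_cut[OF \<open>k \<ge> 2\<close> assms(2)] by (metis (mono_tags, lifting) mem_Collect_eq)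
  next
    fix y assume "y \<in> {?q S | S. is_vertex_cut ?V kneser_adj S}"
    then obtain S where S: "is_vertex_cut ?V kneser_adj S" "y = ?q S" by blast
    show "real n / real k - 1 \<le> y"
      using kneser_cut_bound(1)[OF assms S(1)] pos[OF S(1)] S(2) by (simp add: pos_le_divide_eq)
  qed
  moreover have "\<exists>I. maximum_independent_set ?V kneser_adj I \<and> S = ?V - I"
    if S: "is_vertex_cut ?V kneser_adj S" "toughness ?V kneser_adj = ?q S" for S
  proof (intro exI conjI)
    have "(real n / real k - 1) * real (num_components (?V - S) kneser_adj) = real (card S)"
      using S(2) tough pos[OF S(1)] by (simp add: field_simps)
    then show "maximum_independent_set ?V kneser_adj (?V - S)"
      by (rule kneser_cut_bound(2)[OF assms S(1)])
    show "S = ?V - (?V - S)" using S(1) by (auto simp: is_vertex_cut_def)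
  qed
  ultimately show ?thesis by blast
qed

end
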